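(* Let $k \geq 1$. Then $$2(k-1)n - (k-1)^2 + 3 \leq T^{\uparrow}(n,k) < 16(k+1)^8 n.$$
   Context: Here $n$ (the matrix size) and $k$ are positive integers. An operator system in $M_n(\mathbb{C})$ is a complex linear subspace $\mathcal{V} \subseteq M_n(\mathbb{C})$ containing the identity matrix $I_n$ and such that $A \in \mathcal{V}$ implies $A^* \in \mathcal{V}$, where $A^*$ is the Hermitian (conjugate) transpose. An orthogonal projection is a matrix $P \in M_n(\mathbb{C})$ with $P = P^2 = P^*$, and $P\mathcal{V}P = \{PAP : A \in \mathcal{V}\}$. For an integer $m \geq 1$, a quantum $m$-clique for $\mathcal{V}$ is a rank $m$ orthogonal projection $P \in M_n(\mathbb{C})$ with $\dim(P\mathcal{V}P) = m^2$. Dimensions are over $\mathbb{C}$. The upper quantum Turán number $T^{\uparrow}(n,k)$ is the largest number $d$ such that some operator system in $M_n(\mathbb{C})$ whose dimension is $d$ has no quantum $(k+1)$-cliques.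
   Formalization: The lower bound is claimed only for k not in {n, n+1, n+2}: it equals n² − (n−k+1)² + 3, which exceeds n² ≥ T↑(n,k) for exactly these k (e.g. n = k = 1 gives 3 ≤ 1). The upper bound is proved for all n, k ≥ 1. *)

theory Defs
  imports
    "Jordan_Normal_Form.DL_Rank"
    "Jordan_Normal_Form.Schur_Decomposition"
begin

text \<open>
  Complex dimension of a subspace \<open>W\<close> of the space of \<open>n \<times> n\<close> matrices.
\<close>
definition cdim :: "nat \<Rightarrow> complex mat set \<Rightarrow> nat" where
  "cdim n W = vectorspace.dim class_ring ((module_mat TYPE(complex) n n)\<lparr>carrier := W\<rparr>)"

definition operator_system :: "nat \<Rightarrow> complex mat set \<Rightarrow> bool" where
  "operator_system n V \<longleftrightarrow>
     VectorSpace.subspace class_ring V (module_mat TYPE(complex) n n) \<and>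
     1\<^sub>m n \<in> V \<and> (\<forall>A\<in>V. mat_adjoint A \<in> V)"

definition orthogonal_projection :: "nat \<Rightarrow> complex mat \<Rightarrow> bool" where
  "orthogonal_projection n P \<longleftrightarrow> P \<in> carrier_mat n n \<and> P = P * P \<and> P = mat_adjoint P"

definition quantum_clique :: "nat \<Rightarrow> nat \<Rightarrow> complex mat set \<Rightarrow> complex mat \<Rightarrow> bool" where
  "quantum_clique n m V P \<longleftrightarrow>
     orthogonal_projection n P \<and> vec_space.rank n P = m \<and>
     cdim n {P * A * P | A. A \<in> V} = m\<^sup>2"

text \<open>
  For \<open>n, k \<ge> 1\<close> this set is nonempty (the scalar matrices have no clique of rank at least 2) and
  bounded by \<open>n\<^sup>2\<close>, so its \<open>Max\<close> below is a genuine maximum.  If \<open>k \<ge> n\<close>, no projection has rank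
  \<open>k + 1\<close>, hence the full matrix algebra qualifies and the maximum is \<open>n\<^sup>2\<close>; compare
  \<open>2 (k - 1) n - (k - 1)\<^sup>2 + 3 = n\<^sup>2 - (n - (k - 1))\<^sup>2 + 3\<close>, which is larger than \<open>n\<^sup>2\<close>
  exactly for \<open>k \<in> {n, n + 1, n + 2}\<close>.
\<close>
definition turan_dims :: "nat \<Rightarrow> nat \<Rightarrow> nat set" where
  "turan_dims n k =
     {cdim n V | V. operator_system n V \<and> (\<nexists>P. quantum_clique n (k + 1) V P)}"

definition upper_quantum_turan :: "nat \<Rightarrow> nat \<Rightarrow> nat" where
  "upper_quantum_turan n k = Max (turan_dims n k)"

end

theory Submission
  imports Defs
begin

text \<open>
  Upper bound. Let \<open>m = k + 1\<close> and let \<open>V\<close> have dimension at least \<open>2 m n\<close>. Its at least \<open>2 m n\<close>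
  leading positions fill at least \<open>m\<close> positions in each of \<open>m\<close> rows. For generic \<open>X\<close> with
  \<open>m\<close> columns and \<open>Y\<close> selecting these rows, \<open>Y V X\<close> is the full algebra of \<open>m \<times> m\<close> matrices,
  by block triangularity. Surjectivity is the nonvanishing of a polynomial in \<open>(X, Y)\<close>, and the
  pairs with \<open>Y = X\<^sup>*\<close> are Zariski dense, so some \<open>Z\<^sup>* V Z\<close> is full; the projection onto the
  range of \<open>Z\<close> is then a clique.

  Lower bound. For \<open>k < n\<close> take all matrices whose lower right block of size \<open>n - k + 1\<close> lies in a
  three-dimensional operator system. The range of a projection of rank \<open>k + 1\<close> meets the last
  \<open>n - k + 1\<close> coordinates in dimension at least two, where a full compression would need four
  degrees of freedom. For \<open>k \<ge> n\<close> the full matrix algebra has no clique of rank \<open>k + 1\<close>.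
\<close>

subsection \<open>Linear independence of families and its genericity\<close>

text \<open>The entries of \<open>Z^* A Z\<close> contain conjugates, so fullness of a Hermitian
  compression is not a complex polynomial condition on \<open>Z\<close>. Decoupling the two sides
  removes this obstacle and leaves \<open>Y\<close> free to be a plain selection of rows. A choice
  of \<open>X\<close> suited to one selected row may fail for another, so genericity is needed
  already to find a common \<open>X\<close>. No polynomial in several variables is used: each
  genericity step moves along one complex parameter, where independence of a square family is a
  nonzero determinant and fails only finitely often.

  The threshold \<open>2 m n\<close> comes from counting: up to \<open>m - 1\<close> rows may be
  full and every other row may hold up to \<open>m - 1\<close> leading positions. It lies below
  \<open>16 m^8 n\<close>. In the lower bound, \<open>3 = 2^2 - 1\<close> is the largest block
  dimension that rules out a full compression to two dimensions, and
  \<open>n^2 - (n - h)^2 = 2 h n - h^2\<close> with \<open>h = k - 1\<close> counts the free entries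
  outside the block.\<close>

definition indep_rows :: "'l set \<Rightarrow> 's set \<Rightarrow> ('l \<Rightarrow> 's \<Rightarrow> complex) \<Rightarrow> bool" where
  "indep_rows L S a \<longleftrightarrow> (\<forall>c. (\<forall>s\<in>S. (\<Sum>l\<in>L. c l * a l s) = 0) \<longrightarrow> (\<forall>l\<in>L. c l = 0))"

lemma indep_rowsI:
  assumes "\<And>c l. (\<And>s. s \<in> S \<Longrightarrow> (\<Sum>l\<in>L. c l * a l s) = 0) \<Longrightarrow> l \<in> L \<Longrightarrow> c l = 0"
  shows "indep_rows L S a"
  using assms unfolding indep_rows_def by blast

lemma indep_rowsD:
  assumes "indep_rows L S a" "\<And>s. s \<in> S \<Longrightarrow> (\<Sum>l\<in>L. c l * a l s) = 0" "l \<in> L"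
  shows "c l = 0"
  using assms unfolding indep_rows_def by blast

lemma indep_rows_cong:
  assumes "\<And>l s. l \<in> L \<Longrightarrow> s \<in> S \<Longrightarrow> a l s = b l s"
  shows "indep_rows L S a \<longleftrightarrow> indep_rows L S b"
proof -
  have "(\<Sum>l\<in>L. c l * a l s) = (\<Sum>l\<in>L. c l * b l s)" if "s \<in> S" for c s
    using assms that by (intro sum.cong) auto
  then show ?thesis unfolding indep_rows_def by simp
qed

text \<open>Gaussian elimination: each equation is either vacuous or is used to eliminate one
  unknown.\<close>

lemma underdetermined_system:
  fixes a :: "'l \<Rightarrow> 's \<Rightarrow> complex"
  assumes "finite S" "finite L" "card S < card L"
  shows "\<exists>c. (\<exists>l\<in>L. c l \<noteq> 0) \<and> (\<forall>s\<in>S. (\<Sum>l\<in>L. c l * a l s) = 0)"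
  using assms
proof (induction S arbitrary: L a rule: finite_induct)
  case empty
  then obtain l where "l \<in> L" by fastforce
  then show ?case by (intro exI[of _ "\<lambda>_. 1"]) auto
next
  case (insert s S)
  show ?case
  proof (cases "\<forall>l\<in>L. a l s = 0")
    case True
    have "card S < card L" using insert.prems insert.hyps by simp
    then obtain c where "\<exists>l\<in>L. c l \<noteq> 0" "\<forall>t\<in>S. (\<Sum>l\<in>L. c l * a l t) = 0"
      using insert.IH[of L a] insert.prems(1) by blast
    then show ?thesis using True by (intro exI[of _ c]) simp
  next
    case False
    then obtain k where k: "k \<in> L" "a k s \<noteq> 0" by blast
    \<comment> \<open>Column \<open>s\<close> is cleared with pivot \<open>a k s\<close>. The
      coefficient of \<open>d\<close> at \<open>k\<close> is then chosen so that \<open>d\<close>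
      has the same sums against \<open>a\<close> as \<open>c\<close> has against
      \<open>b\<close>.\<close>
    define b where "b = (\<lambda>l t. a l t - a l s / a k s * a k t)"
    have "card S < card (L - {k})" using insert.prems insert.hyps k by simp
    then obtain c where c: "\<exists>l\<in>L - {k}. c l \<noteq> 0" "\<forall>t\<in>S. (\<Sum>l\<in>L - {k}. c l * b l t) = 0"
      using insert.IH[of "L - {k}" b] insert.prems by auto
    define d where "d = c(k := - (\<Sum>l\<in>L - {k}. c l * a l s / a k s))"
    have split: "(\<Sum>l\<in>L. d l * a l t) = (\<Sum>l\<in>L - {k}. c l * b l t)" for t
    proof -
      have "(\<Sum>l\<in>L. d l * a l t) = d k * a k t + (\<Sum>l\<in>L - {k}. d l * a l t)"
        using insert.prems k by (simp add: sum.remove)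
      also have "(\<Sum>l\<in>L - {k}. d l * a l t) = (\<Sum>l\<in>L - {k}. c l * a l t)"
        unfolding d_def by (intro sum.cong) auto
      also have "d k * a k t = (\<Sum>l\<in>L - {k}. - (c l * (a l s / a k s) * a k t))"
        by (simp add: d_def sum_distrib_right sum_negf)
      finally show ?thesis
        unfolding b_def by (simp add: sum.distrib[symmetric] algebra_simps)
    qed
    have "b l s = 0" for l using k by (simp add: b_def)
    then have "(\<Sum>l\<in>L. d l * a l s) = 0" unfolding split by simp
    moreover have "\<exists>l\<in>L. d l \<noteq> 0" using c(1) by (auto simp: d_def)
    ultimately show ?thesis using split c(2) by (intro exI[of _ d]) auto
  qed
qed

lemma indep_rows_card_le:
  assumes "finite S" "finite L" "indep_rows L S a"
  shows "card L \<le> card S"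
proof (rule ccontr)
  assume "\<not> card L \<le> card S"
  then obtain c where "\<exists>l\<in>L. c l \<noteq> 0" "\<forall>s\<in>S. (\<Sum>l\<in>L. c l * a l s) = 0"
    using underdetermined_system[OF assms(1,2), of a] by auto
  then show False using assms(3) unfolding indep_rows_def by blast
qed

definition family_mat :: "(nat \<Rightarrow> 'l) \<Rightarrow> (nat \<Rightarrow> 's) \<Rightarrow> nat \<Rightarrow> ('l \<Rightarrow> 's \<Rightarrow> complex) \<Rightarrow> complex mat" where
  "family_mat f g N a = mat N N (\<lambda>(i, j). a (f i) (g j))"

text \<open>A relation among the rows is a kernel vector of the transpose. Independence of a square
  family thus becomes one polynomial condition on its entries; the choice of enumerations affects
  only the sign of the determinant.\<close>

lemma indep_rows_iff_det:
  assumes f: "bij_betw f {..<N} L" and g: "bij_betw g {..<N} S"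
  shows "indep_rows L S a \<longleftrightarrow> det (family_mat f g N a) \<noteq> 0"
proof -
  let ?M = "family_mat f g N a"
  have M: "?M \<in> carrier_mat N N" by (simp add: family_mat_def)
  have prod: "(?M\<^sup>T *\<^sub>v v) $ j = (\<Sum>i<N. v $ i * a (f i) (g j))" if "v \<in> carrier_vec N" "j < N" for v j
    using that by (simp add: family_mat_def scalar_prod_def mult.commute lessThan_atLeast0)
  have reindex: "(\<Sum>l\<in>L. c l * a l s) = (\<Sum>i<N. c (f i) * a (f i) s)" for c s
    by (simp add: sum.reindex_bij_betw[OF f, symmetric])
  have gS: "(\<forall>s\<in>S. Q s) \<longleftrightarrow> (\<forall>j<N. Q (g j))" for Q
    using bij_betw_imp_surj_on[OF g] by auto
  have fL: "(\<forall>l\<in>L. Q l) \<longleftrightarrow> (\<forall>i<N. Q (f i))" for Q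
    using bij_betw_imp_surj_on[OF f] by auto
  have "det ?M = det ?M\<^sup>T" using det_transpose[OF M] by simp
  also have "\<dots> = 0 \<longleftrightarrow> (\<exists>v. v \<in> carrier_vec N \<and> v \<noteq> 0\<^sub>v N \<and> ?M\<^sup>T *\<^sub>v v = 0\<^sub>v N)"
    using M by (intro det_0_iff_vec_prod_zero) simp
  also have "\<dots> \<longleftrightarrow> \<not> indep_rows L S a"
  proof
    assume "\<exists>v. v \<in> carrier_vec N \<and> v \<noteq> 0\<^sub>v N \<and> ?M\<^sup>T *\<^sub>v v = 0\<^sub>v N"
    then obtain v where v: "v \<in> carrier_vec N" "v \<noteq> 0\<^sub>v N" "?M\<^sup>T *\<^sub>v v = 0\<^sub>v N" by blast
    define c where "c l = v $ (the_inv_into {..<N} f l)" for l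
    have c: "c (f i) = v $ i" if "i < N" for i
      using that f by (simp add: c_def the_inv_into_f_f bij_betw_def)
    have "(\<Sum>i<N. c (f i) * a (f i) (g j)) = 0" if "j < N" for j
      using prod[OF v(1) that] v(3) that c by simp
    then have "\<forall>s\<in>S. (\<Sum>l\<in>L. c l * a l s) = 0" by (simp add: reindex gS)
    moreover have "\<not> (\<forall>l\<in>L. c l = 0)"
    proof
      assume "\<forall>l\<in>L. c l = 0"
      then have "v = 0\<^sub>v N" using v(1) c fL[of "\<lambda>l. c l = 0"] by (intro eq_vecI) auto
      then show False using v(2) by simp
    qed
    ultimately show "\<not> indep_rows L S a" unfolding indep_rows_def by blast
  next
    assume "\<not> indep_rows L S a"
    then obtain c where c: "\<forall>s\<in>S. (\<Sum>l\<in>L. c l * a l s) = 0" "\<not> (\<forall>l\<in>L. c l = 0)"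
      unfolding indep_rows_def by blast
    define v where "v = vec N (\<lambda>i. c (f i))"
    have v: "v \<in> carrier_vec N" by (simp add: v_def)
    have "?M\<^sup>T *\<^sub>v v = 0\<^sub>v N"
    proof (intro eq_vecI)
      fix j assume "j < dim_vec (0\<^sub>v N :: complex vec)"
      then have j: "j < N" by simp
      have "(\<Sum>i<N. v $ i * a (f i) (g j)) = (\<Sum>i<N. c (f i) * a (f i) (g j))"
        by (simp add: v_def)
      also have "\<dots> = 0" using c(1) j by (simp add: reindex gS)
      finally show "(?M\<^sup>T *\<^sub>v v) $ j = 0\<^sub>v N $ j" using prod[OF v j] j by simp
    qed (use M in simp)
    moreover have "v \<noteq> 0\<^sub>v N"
    proof -
      obtain i where i: "i < N" "c (f i) \<noteq> 0" using c(2) unfolding fL by blast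
      then have "v $ i \<noteq> 0\<^sub>v N $ i" by (simp add: v_def)
      then show ?thesis by auto
    qed
    ultimately show "\<exists>v. v \<in> carrier_vec N \<and> v \<noteq> 0\<^sub>v N \<and> ?M\<^sup>T *\<^sub>v v = 0\<^sub>v N" using v by blast
  qed
  finally show ?thesis by simp
qed

lemma obtain_enumerations:
  assumes "finite L" "finite S" "card L = card S"
  obtains f g where "bij_betw f {..<card L} L" "bij_betw g {..<card L} S"
  using ex_bij_betw_nat_finite[OF assms(1)] ex_bij_betw_nat_finite[OF assms(2)] assms(3)
  by (metis lessThan_atLeast0)

lemma indep_rows_transpose:
  assumes "finite L" "finite S" "card L = card S" "indep_rows L S a"
  shows "indep_rows S L (\<lambda>s l. a l s)"
proof -
  obtain f g where f: "bij_betw f {..<card L} L" and g: "bij_betw g {..<card L} S"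
    using obtain_enumerations[OF assms(1-3)] .
  have "family_mat g f (card L) (\<lambda>s l. a l s) = (family_mat f g (card L) a)\<^sup>T"
    by (intro eq_matI) (auto simp: family_mat_def)
  moreover have "family_mat f g (card L) a \<in> carrier_mat (card L) (card L)"
    by (simp add: family_mat_def)
  ultimately show ?thesis
    using assms(4) det_transpose[of "family_mat f g (card L) a"]
    by (simp add: indep_rows_iff_det[OF f g] indep_rows_iff_det[OF g f])
qed

section \<open>Families depending polynomially on one complex parameter\<close>

lemma range_poly_const: "(\<lambda>t. c) \<in> range (poly :: complex poly \<Rightarrow> _)"
  by (rule range_eqI[of _ _ "[:c:]"]) auto

lemma range_poly_ident: "(\<lambda>t. t) \<in> range (poly :: complex poly \<Rightarrow> _)"
  by (rule range_eqI[of _ _ "[:0, 1:]"]) auto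

lemma range_poly_add:
  assumes "f \<in> range (poly :: complex poly \<Rightarrow> _)" "g \<in> range poly"
  shows "(\<lambda>t. f t + g t) \<in> range poly"
proof -
  obtain p q where "f = poly p" "g = poly q" using assms by auto
  then show ?thesis by (intro range_eqI[of _ _ "p + q"]) auto
qed

lemma range_poly_mult:
  assumes "f \<in> range (poly :: complex poly \<Rightarrow> _)" "g \<in> range poly"
  shows "(\<lambda>t. f t * g t) \<in> range poly"
proof -
  obtain p q where "f = poly p" "g = poly q" using assms by auto
  then show ?thesis by (intro range_eqI[of _ _ "p * q"]) auto
qed

lemma range_poly_sum:
  assumes "\<And>i. i \<in> I \<Longrightarrow> f i \<in> range (poly :: complex poly \<Rightarrow> _)"
  shows "(\<lambda>t. \<Sum>i\<in>I. f i t) \<in> range poly"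
  using assms
  by (induction I rule: infinite_finite_induct) (auto intro: range_poly_const range_poly_add)

lemma range_poly_prod:
  assumes "\<And>i. i \<in> I \<Longrightarrow> f i \<in> range (poly :: complex poly \<Rightarrow> _)"
  shows "(\<lambda>t. \<Prod>i\<in>I. f i t) \<in> range poly"
  using assms
  by (induction I rule: infinite_finite_induct) (auto intro: range_poly_const range_poly_mult)

lemmas range_poly_intros =
  range_poly_const range_poly_ident range_poly_add range_poly_mult range_poly_sum range_poly_prod

lemma finite_zeros_range_poly:
  assumes "f \<in> range (poly :: complex poly \<Rightarrow> _)" "f t0 \<noteq> 0"
  shows "finite {t. f t = 0}"
proof -
  obtain p where p: "f = poly p" using assms(1) by blast
  then have "p \<noteq> 0" using assms(2) by auto
  then show ?thesis unfolding p by (rule poly_roots_finite)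
qed

text \<open>By the Leibniz formula the determinant is a polynomial in \<open>t\<close>. It is
  nonzero at \<open>t0\<close>, so it has finitely many roots.\<close>

lemma finite_degenerate_parameters:
  fixes a :: "complex \<Rightarrow> 'l \<Rightarrow> 's \<Rightarrow> complex"
  assumes "finite L" "finite S" "card L = card S"
    and poly: "\<And>l s. l \<in> L \<Longrightarrow> s \<in> S \<Longrightarrow> (\<lambda>t. a t l s) \<in> range poly"
    and "indep_rows L S (a t0)"
  shows "finite {t. \<not> indep_rows L S (a t)}"
proof -
  obtain f g where f: "bij_betw f {..<card L} L" and g: "bij_betw g {..<card L} S"
    using obtain_enumerations[OF assms(1-3)] .
  let ?N = "card L"
  have "(\<lambda>t. det (family_mat f g ?N (a t))) =
    (\<lambda>t. \<Sum>p\<in>{p. p permutes {0..<?N}}. signof p * (\<Prod>i\<in>{0..<?N}. a t (f i) (g (p i))))"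
    unfolding family_mat_def
    by (auto simp: det_def intro!: ext sum.cong prod.cong)
  also have "\<dots> \<in> range poly"
    using bij_betw_imp_surj_on[OF f] bij_betw_imp_surj_on[OF g]
    by (intro range_poly_intros poly) auto
  finally have "finite {t. det (family_mat f g ?N (a t)) = 0}"
    using assms(5) finite_zeros_range_poly unfolding indep_rows_iff_det[OF f g] by blast
  then show ?thesis unfolding indep_rows_iff_det[OF f g] by simp
qed

lemma sum_unit_functional:
  assumes "finite E" "q \<in> E"
  shows "(\<Sum>p\<in>E. (if p = q then 1 else 0) * f p) = (f q :: complex)"
proof -
  have "(\<Sum>p\<in>E. (if p = q then 1 else 0) * f p) = (\<Sum>p\<in>E. if p = q then f p else 0)"
    by (intro sum.cong) auto
  then show ?thesis using assms by simp
qed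

subsection \<open>Dimension and rank in coordinates\<close>

text \<open>Kept abstract because it is used twice: for subspaces of matrices with their entries,
  and for column spans with the vector components. It translates the dimension of a carrier into
  bounds on \<open>indep_rows\<close> families.\<close>

locale coordinate_space =
  fixes V :: "(complex, 'b, 'm) module_scheme" and E :: "'i set" and e :: "'b \<Rightarrow> 'i \<Rightarrow> complex"
  assumes vs: "vectorspace (class_ring :: complex ring) V"
    and finite_E: "finite E"
    and e_add: "v \<in> carrier V \<Longrightarrow> w \<in> carrier V \<Longrightarrow> i \<in> E \<Longrightarrow> e (v \<oplus>\<^bsub>V\<^esub> w) i = e v i + e w i"
    and e_smult: "v \<in> carrier V \<Longrightarrow> i \<in> E \<Longrightarrow> e (c \<odot>\<^bsub>V\<^esub> v) i = c * e v i"
    and e_inject: "v \<in> carrier V \<Longrightarrow> w \<in> carrier V \<Longrightarrow> (\<And>i. i \<in> E \<Longrightarrow> e v i = e w i) \<Longrightarrow> v = w"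
begin

sublocale vectorspace "class_ring :: complex ring" V by (rule vs)

lemma smult_in_carrier: "v \<in> carrier V \<Longrightarrow> c \<odot>\<^bsub>V\<^esub> v \<in> carrier V"
  using smult_closed[of c v] by simp

lemma e_zero: "i \<in> E \<Longrightarrow> e \<zero>\<^bsub>V\<^esub> i = 0"
  using e_add[of "\<zero>\<^bsub>V\<^esub>" "\<zero>\<^bsub>V\<^esub>" i] by simp

lemma ex_combination:
  assumes "finite I" "\<And>l. l \<in> I \<Longrightarrow> b l \<in> carrier V"
  shows "\<exists>v\<in>carrier V. \<forall>i\<in>E. e v i = (\<Sum>l\<in>I. c l * e (b l) i)"
  using assms
proof (induction I rule: finite_induct)
  case empty
  then show ?case using e_zero by (intro bexI[of _ "\<zero>\<^bsub>V\<^esub>"]) auto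
next
  case (insert k I)
  then obtain v where v: "v \<in> carrier V" "\<forall>i\<in>E. e v i = (\<Sum>l\<in>I. c l * e (b l) i)" by auto
  then show ?case using insert.hyps insert.prems[of k] e_add e_smult smult_in_carrier
    by (intro bexI[of _ "(c k \<odot>\<^bsub>V\<^esub> b k) \<oplus>\<^bsub>V\<^esub> v"]) auto
qed

lemma e_lincomb:
  assumes "finite A" "A \<subseteq> carrier V" "i \<in> E"
  shows "e (lincomb a A) i = (\<Sum>v\<in>A. a v * e v i)"
  using assms(1,2)
proof (induction A rule: finite_induct)
  case empty
  then show ?case using e_zero assms(3) by (simp add: lincomb_def)
next
  case (insert w A)
  then have "lincomb a (insert w A) = (a w \<odot>\<^bsub>V\<^esub> w) \<oplus>\<^bsub>V\<^esub> lincomb a A"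
    unfolding lincomb_def by (intro finsum_insert) (auto intro!: smult_in_carrier)
  moreover have "lincomb a A \<in> carrier V" using insert.prems insert.hyps by (intro lincomb_closed) auto
  ultimately show ?case
    using insert e_add e_smult smult_in_carrier assms(3) by simp
qed

lemma lin_indpt_iff_indep_rows:
  assumes "finite A" "A \<subseteq> carrier V"
  shows "lin_indpt A \<longleftrightarrow> indep_rows A E e"
proof
  assume li: "lin_indpt A"
  show "indep_rows A E e"
  proof (rule indep_rowsI, rule ccontr)
    fix c v
    assume *: "\<And>i. i \<in> E \<Longrightarrow> (\<Sum>v\<in>A. c v * e v i) = 0" "v \<in> A" "c v \<noteq> 0"
    have "lincomb c A = \<zero>\<^bsub>V\<^esub>"
      using assms * e_lincomb e_zero by (intro e_inject lincomb_closed) auto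
    then show False using lin_dep_crit[of A A c v] assms * li by simp
  qed
next
  assume ind: "indep_rows A E e"
  show "lin_indpt A"
  proof
    assume "lin_dep A"
    then obtain a v where a: "lincomb a A = \<zero>\<^bsub>V\<^esub>" "v \<in> A" "a v \<noteq> 0"
      using finite_lin_dep[of A] assms by auto
    have "(\<Sum>v\<in>A. a v * e v i) = 0" if "i \<in> E" for i
      using e_lincomb[OF assms that, of a] e_zero that a(1) by simp
    then show False using indep_rowsD[OF ind] a by blast
  qed
qed

text \<open>Independent sets have at most \<open>card E\<close> elements, so a maximal one exists,
  and a maximal independent set generates.\<close>

lemma finite_dimensional: "fin_dim"
proof -
  have bound: "finite A \<and> card A \<le> card E" if A: "A \<subseteq> carrier V \<and> lin_indpt A" for A
  proof -
    have le: "card B \<le> card E" if B: "finite B" "B \<subseteq> A" for B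
    proof -
      have "lin_indpt B" using A B subset_li_is_li by blast
      then show ?thesis
        using B A lin_indpt_iff_indep_rows[of B] indep_rows_card_le[OF finite_E] by blast
    qed
    \<comment> \<open>\<open>card A\<close> is \<open>0\<close> for infinite \<open>A\<close>, so a
      bound on the cardinality alone would not exclude that case; a finite subset with one element
      too many does.\<close>
    have "finite A"
    proof (rule ccontr)
      assume "infinite A"
      then obtain B where "B \<subseteq> A" "finite B" "card B = Suc (card E)"
        using infinite_arbitrarily_large by metis
      then show False using le[of B] by simp
    qed
    then show ?thesis using le by blast
  qed
  have "\<exists>A. finite A \<and> maximal A (\<lambda>S. S \<subseteq> carrier V \<and> lin_indpt S)"
    by (rule maximal_exists[OF bound, of _ "{}"]) (auto simp: lin_dep_def)
  then obtain A where "finite A" "maximal A (\<lambda>S. S \<subseteq> carrier V \<and> lin_indpt S)" by blast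
  then show ?thesis using max_li_is_gen[of A] unfolding fin_dim_def maximal_def by blast
qed

lemma obtain_basis:
  obtains b :: "nat \<Rightarrow> 'b" where
    "\<And>l. l < dim \<Longrightarrow> b l \<in> carrier V"
    "indep_rows {..<dim} E (\<lambda>l. e (b l))"
    "\<And>v. v \<in> carrier V \<Longrightarrow> \<exists>c. \<forall>i\<in>E. e v i = (\<Sum>l<dim. c l * e (b l) i)"
proof -
  obtain B where B: "finite B" "basis B" using finite_basis_exists[OF finite_dimensional] by blast
  have BV: "B \<subseteq> carrier V" and li: "lin_indpt B" and gen: "span B = carrier V"
    using B unfolding basis_def by auto
  have "card B = dim" using dim_basis[OF B] by simp
  then obtain b where b: "bij_betw b {..<dim} B"
    using ex_bij_betw_nat_finite[OF B(1)] by (metis lessThan_atLeast0)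
  have ind: "indep_rows B E e" using li lin_indpt_iff_indep_rows[OF B(1) BV] by blast
  show ?thesis
  proof (rule that[of b])
    show "b l \<in> carrier V" if "l < dim" for l using b BV that by (auto simp: bij_betw_def)
    show "indep_rows {..<dim} E (\<lambda>l. e (b l))"
    proof (rule indep_rowsI)
      fix c l assume c: "\<And>i. i \<in> E \<Longrightarrow> (\<Sum>l<dim. c l * e (b l) i) = 0" and l: "l \<in> {..<dim}"
      define d where "d v = c (the_inv_into {..<dim} b v)" for v
      have d: "d (b l) = c l" if "l < dim" for l
        using that b by (simp add: d_def the_inv_into_f_f bij_betw_def)
      have "(\<Sum>v\<in>B. d v * e v i) = 0" if "i \<in> E" for i
        using c[OF that] d by (simp add: sum.reindex_bij_betw[OF b, symmetric])
      then have "d (b l) = 0" using indep_rowsD[OF ind] bij_betwE[OF b] l by blast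
      then show "c l = 0" using d l by simp
    qed
    show "\<exists>c. \<forall>i\<in>E. e v i = (\<Sum>l<dim. c l * e (b l) i)" if v: "v \<in> carrier V" for v
    proof -
      obtain a where "lincomb a B = v" using finite_in_span[OF B(1) BV] v gen by blast
      then have "\<forall>i\<in>E. e v i = (\<Sum>l<dim. a (b l) * e (b l) i)"
        using e_lincomb[OF B(1) BV] by (auto simp: sum.reindex_bij_betw[OF b, symmetric])
      then show ?thesis by (rule exI[of _ "\<lambda>l. a (b l)"])
    qed
  qed
qed

text \<open>The coefficients of the \<open>f l\<close> in terms of the \<open>u j\<close> inherit
  independence, because a relation among the coefficient rows is a relation among the
  \<open>f l\<close>.\<close>

lemma indep_card_le_spanning:
  assumes "finite I" "finite J" and ind: "indep_rows I E f"
    and span: "\<And>l. l \<in> I \<Longrightarrow> \<exists>c. \<forall>i\<in>E. f l i = (\<Sum>j\<in>J. c j * u j i)"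
  shows "card I \<le> card J"
proof -
  obtain C where C: "\<And>l i. l \<in> I \<Longrightarrow> i \<in> E \<Longrightarrow> f l i = (\<Sum>j\<in>J. C l j * u j i)"
    using span by metis
  have "indep_rows I J C"
  proof (rule indep_rowsI)
    fix c l assume c: "\<And>j. j \<in> J \<Longrightarrow> (\<Sum>l\<in>I. c l * C l j) = 0" and l: "l \<in> I"
    have "(\<Sum>l\<in>I. c l * f l i) = 0" if i: "i \<in> E" for i
    proof -
      have "(\<Sum>l\<in>I. c l * f l i) = (\<Sum>l\<in>I. \<Sum>j\<in>J. c l * C l j * u j i)"
        using C i by (simp add: sum_distrib_left mult.assoc)
      also have "\<dots> = (\<Sum>j\<in>J. (\<Sum>l\<in>I. c l * C l j) * u j i)"
        by (subst sum.swap) (simp add: sum_distrib_right)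
      finally show ?thesis using c by simp
    qed
    then show "c l = 0" using indep_rowsD[OF ind] l by blast
  qed
  then show ?thesis using indep_rows_card_le assms by blast
qed

lemma card_le_dim:
  assumes "finite I" "\<And>l. l \<in> I \<Longrightarrow> b l \<in> carrier V" "indep_rows I E (\<lambda>l. e (b l))"
  shows "card I \<le> dim"
proof -
  obtain \<beta> :: "nat \<Rightarrow> 'b" where \<beta>: "\<And>l. l < dim \<Longrightarrow> \<beta> l \<in> carrier V"
    "indep_rows {..<dim} E (\<lambda>l. e (\<beta> l))"
    "\<And>v. v \<in> carrier V \<Longrightarrow> \<exists>c. \<forall>i\<in>E. e v i = (\<Sum>l<dim. c l * e (\<beta> l) i)"
    by (rule obtain_basis) (rule that)
  have "card I \<le> card {..<dim}"
    by (rule indep_card_le_spanning[OF assms(1) _ assms(3), of _ "\<lambda>l. e (\<beta> l)"]) (use \<beta>(3) assms(2) in auto)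
  then show ?thesis by simp
qed

lemma dim_le_card:
  assumes "finite J" "\<And>v. v \<in> carrier V \<Longrightarrow> \<exists>c. \<forall>i\<in>E. e v i = (\<Sum>j\<in>J. c j * u j i)"
  shows "dim \<le> card J"
proof -
  obtain \<beta> :: "nat \<Rightarrow> 'b" where \<beta>: "\<And>l. l < dim \<Longrightarrow> \<beta> l \<in> carrier V"
    "indep_rows {..<dim} E (\<lambda>l. e (\<beta> l))"
    "\<And>v. v \<in> carrier V \<Longrightarrow> \<exists>c. \<forall>i\<in>E. e v i = (\<Sum>l<dim. c l * e (\<beta> l) i)"
    by (rule obtain_basis) (rule that)
  have "card {..<dim} \<le> card J"
    by (rule indep_card_le_spanning[OF _ assms(1) \<beta>(2), of u]) (use \<beta>(1) assms(2) in auto)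
  then show ?thesis by simp
qed

text \<open>The functionals \<open>w j\<close> separate the points of the space, so evaluating them
  embeds it into the functions on \<open>J\<close> and keeps a basis independent.\<close>

lemma dim_le_card_functionals:
  assumes "finite J"
    and sep: "\<And>v i. v \<in> carrier V \<Longrightarrow> (\<And>j. j \<in> J \<Longrightarrow> (\<Sum>i\<in>E. w j i * e v i) = 0) \<Longrightarrow> i \<in> E \<Longrightarrow> e v i = 0"
  shows "dim \<le> card J"
proof -
  obtain \<beta> :: "nat \<Rightarrow> 'b" where \<beta>: "\<And>l. l < dim \<Longrightarrow> \<beta> l \<in> carrier V"
    "indep_rows {..<dim} E (\<lambda>l. e (\<beta> l))"
    "\<And>v. v \<in> carrier V \<Longrightarrow> \<exists>c. \<forall>i\<in>E. e v i = (\<Sum>l<dim. c l * e (\<beta> l) i)"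
    by (rule obtain_basis) (rule that)
  have "indep_rows {..<dim} J (\<lambda>l j. \<Sum>i\<in>E. w j i * e (\<beta> l) i)"
  proof (rule indep_rowsI)
    fix c l
    assume c: "\<And>j. j \<in> J \<Longrightarrow> (\<Sum>l<dim. c l * (\<Sum>i\<in>E. w j i * e (\<beta> l) i)) = 0" and l: "l \<in> {..<dim}"
    obtain v where v: "v \<in> carrier V" "\<And>i. i \<in> E \<Longrightarrow> e v i = (\<Sum>l<dim. c l * e (\<beta> l) i)"
      using ex_combination[of "{..<dim}" \<beta> c] \<beta>(1) by auto
    have "(\<Sum>i\<in>E. w j i * e v i) = (\<Sum>l<dim. c l * (\<Sum>i\<in>E. w j i * e (\<beta> l) i))" for j
    proof -
      have "(\<Sum>i\<in>E. w j i * e v i) = (\<Sum>i\<in>E. \<Sum>l<dim. c l * (w j i * e (\<beta> l) i))"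
        using v(2) by (simp add: sum_distrib_left mult.left_commute)
      then show ?thesis by (subst (asm) sum.swap) (simp add: sum_distrib_left)
    qed
    then have "(\<Sum>i\<in>E. w j i * e v i) = 0" if "j \<in> J" for j using c[OF that] by simp
    then have "e v i = 0" if "i \<in> E" for i using that by (intro sep[OF v(1)]) auto
    then have "(\<Sum>l<dim. c l * e (\<beta> l) i) = 0" if "i \<in> E" for i using v(2)[OF that] that by simp
    then show "c l = 0" by (rule indep_rowsD[OF \<beta>(2) _ l])
  qed
  then show ?thesis using indep_rows_card_le[of J "{..<dim}"] assms(1) by simp
qed

end

section \<open>Subspaces of matrices, column spans and rank\<close>

abbreviation positions :: "nat \<Rightarrow> (nat \<times> nat) set" where
  "positions n \<equiv> {..<n} \<times> {..<n}"

abbreviation mat_subspace :: "nat \<Rightarrow> complex mat set \<Rightarrow> bool" where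
  "mat_subspace n W \<equiv> VectorSpace.subspace class_ring W (module_mat TYPE(complex) n n)"

lemma mat_subspaceI:
  assumes "W \<subseteq> carrier_mat n n" "0\<^sub>m n n \<in> W"
    and "\<And>A B. A \<in> W \<Longrightarrow> B \<in> W \<Longrightarrow> A + B \<in> W"
    and "\<And>c A. A \<in> W \<Longrightarrow> c \<cdot>\<^sub>m A \<in> W"
  shows "mat_subspace n W"
proof -
  have "Module.module (class_ring :: complex ring) (module_mat TYPE(complex) n n)"
    using matrix_vs[where 'a = complex, of n n] by (simp add: vectorspace_def)
  then have "submodule class_ring W (module_mat TYPE(complex) n n)"
    unfolding submodule_def using assms by (simp add: module_mat_simps)
  then show ?thesis unfolding VectorSpace.subspace_def using matrix_vs by blast
qed

lemma mat_subspaceD: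
  assumes "mat_subspace n W"
  shows "W \<subseteq> carrier_mat n n" "0\<^sub>m n n \<in> W"
    and "\<And>A B. A \<in> W \<Longrightarrow> B \<in> W \<Longrightarrow> A + B \<in> W"
    and "\<And>c A. A \<in> W \<Longrightarrow> c \<cdot>\<^sub>m A \<in> W"
  using assms unfolding VectorSpace.subspace_def submodule_def by (simp_all add: module_mat_simps)

lemma coordinate_space_mat:
  assumes W: "mat_subspace n W"
  shows "coordinate_space ((module_mat TYPE(complex) n n)\<lparr>carrier := W\<rparr>) (positions n) (\<lambda>A p. A $$ p)"
proof (rule coordinate_space.intro)
  show "vectorspace class_ring ((module_mat TYPE(complex) n n)\<lparr>carrier := W\<rparr>)"
    using vectorspace.subspace_is_vs[OF matrix_vs W] .
  fix A B :: "complex mat"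
  assume "A \<in> carrier ((module_mat TYPE(complex) n n)\<lparr>carrier := W\<rparr>)"
    and "B \<in> carrier ((module_mat TYPE(complex) n n)\<lparr>carrier := W\<rparr>)"
    and eq: "\<And>p. p \<in> positions n \<Longrightarrow> A $$ p = B $$ p"
  then have "A \<in> carrier_mat n n" "B \<in> carrier_mat n n" using mat_subspaceD(1)[OF W] by auto
  then show "A = B" using eq by (intro eq_matI) auto
qed (use mat_subspaceD(1)[OF W] in \<open>auto simp: module_mat_simps\<close>)

lemma coordinate_space_col_span:
  assumes "P \<in> carrier_mat n m"
  shows "coordinate_space ((module_vec TYPE(complex) n)\<lparr>carrier := LinearCombinations.module.span class_ring
    (module_vec TYPE(complex) n) (set (cols P))\<rparr>) {..<n} (\<lambda>v i. v $ i)"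
proof -
  interpret vec_space "TYPE(complex)" n .
  have C: "set (cols P) \<subseteq> carrier_vec n" using assms cols_dim by blast
  have S: "span (set (cols P)) \<subseteq> carrier_vec n" using span_is_subset2[OF C] by simp
  show ?thesis
  proof (rule coordinate_space.intro)
    show "vectorspace class_ring (span_vs (set (cols P)))"
      using subspace_is_vs[OF span_is_subspace[OF C]] .
    fix v w
    assume "v \<in> carrier (span_vs (set (cols P)))" "w \<in> carrier (span_vs (set (cols P)))"
      and eq: "\<And>i. i \<in> {..<n} \<Longrightarrow> v $ i = w $ i"
    then have "v \<in> carrier_vec n" "w \<in> carrier_vec n" using S by auto
    then show "v = w" using eq by (intro eq_vecI) auto
  qed (use S in \<open>auto simp: module_vec_simps\<close>)
qed

lemma card_le_cdim:
  assumes W: "mat_subspace n W" and "finite I" "\<And>l. l \<in> I \<Longrightarrow> b l \<in> W"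
    and "indep_rows I (positions n) (\<lambda>l p. b l $$ p)"
  shows "card I \<le> cdim n W"
proof -
  interpret coordinate_space "(module_mat TYPE(complex) n n)\<lparr>carrier := W\<rparr>" "positions n" "\<lambda>A p. A $$ p"
    using coordinate_space_mat[OF W] .
  show ?thesis using card_le_dim[of I b] assms unfolding cdim_def by simp
qed

lemma cdim_le_card_functionals:
  assumes W: "mat_subspace n W" and "finite J"
    and "\<And>A i j. A \<in> W \<Longrightarrow> (\<And>j. j \<in> J \<Longrightarrow> (\<Sum>p\<in>positions n. w j p * A $$ p) = 0) \<Longrightarrow>
      i < n \<Longrightarrow> j < n \<Longrightarrow> A $$ (i, j) = 0"
  shows "cdim n W \<le> card J"
proof -
  interpret coordinate_space "(module_mat TYPE(complex) n n)\<lparr>carrier := W\<rparr>" "positions n" "\<lambda>A p. A $$ p"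
    using coordinate_space_mat[OF W] .
  show ?thesis unfolding cdim_def using assms by (intro dim_le_card_functionals[of J w]) auto
qed

lemma cdim_le_square:
  assumes "mat_subspace n W"
  shows "cdim n W \<le> n\<^sup>2"
proof -
  have "cdim n W \<le> card (positions n)"
  proof (rule cdim_le_card_functionals[OF assms, of _ "\<lambda>q p. if p = q then 1 else 0"])
    fix A :: "complex mat" and i j
    assume *: "\<And>q. q \<in> positions n \<Longrightarrow> (\<Sum>p\<in>positions n. (if p = q then 1 else 0) * A $$ p) = 0"
      and "i < n" "j < n"
    then show "A $$ (i, j) = 0"
      using *[of "(i, j)"] sum_unit_functional[of "positions n" "(i, j)" "\<lambda>p. A $$ p"] by simp
  qed simp
  then show ?thesis by (simp add: card_cartesian_product power2_eq_square)
qed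

text \<open>A rank factorization: \<open>b\<close> is a basis of the column space and
  \<open>C\<close> holds the coordinates of the columns. That each \<open>b l\<close> is an image
  under \<open>P\<close> later shows that a projection \<open>P\<close> fixes it.\<close>

lemma rank_obtain_spanning:
  assumes P: "P \<in> carrier_mat n m"
  obtains b :: "nat \<Rightarrow> complex vec" and C where
    "\<And>l. l < vec_space.rank n P \<Longrightarrow> \<exists>x\<in>carrier_vec m. P *\<^sub>v x = b l"
    "\<And>i j. i < n \<Longrightarrow> j < m \<Longrightarrow> P $$ (i, j) = (\<Sum>l<vec_space.rank n P. b l $ i * C l j)"
proof -
  interpret vec_space "TYPE(complex)" n .
  interpret S: coordinate_space "span_vs (set (cols P))" "{..<n}" "\<lambda>v i. v $ i"
    using coordinate_space_col_span[OF P] .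
  have dim: "S.dim = rank P" by (simp add: rank_def)
  have C: "set (cols P) \<subseteq> carrier_vec n" using P cols_dim by blast
  obtain b :: "nat \<Rightarrow> complex vec" where b:
    "\<And>l. l < rank P \<Longrightarrow> b l \<in> span (set (cols P))"
    "\<And>v. v \<in> span (set (cols P)) \<Longrightarrow> \<exists>c. \<forall>i\<in>{..<n}. v $ i = (\<Sum>l<rank P. c l * b l $ i)"
    by (rule S.obtain_basis[unfolded dim]) (rule that, simp_all)
  have "\<exists>c. \<forall>i<n. P $$ (i, j) = (\<Sum>l<rank P. c l * b l $ i)" if "j < m" for j
  proof -
    have "col P j \<in> set (cols P)" using P that by (simp add: cols_def)
    then have "col P j \<in> span (set (cols P))" using in_own_span[OF C] by blast
    then show ?thesis using b(2)[of "col P j"] P that by auto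
  qed
  then obtain D where D: "\<And>j i. j < m \<Longrightarrow> i < n \<Longrightarrow> P $$ (i, j) = (\<Sum>l<rank P. D j l * b l $ i)"
    by metis
  have "\<exists>x\<in>carrier_vec m. P *\<^sub>v x = b l" if "l < rank P" for l
    using b(1)[OF that] col_space_eq[OF P] P unfolding col_space_def by simp
  then show ?thesis by (rule that[of b "\<lambda>l j. D j l"]) (simp_all add: D mult.commute)
qed

text \<open>\<open>P = Z * Y\<close> puts the range of \<open>P\<close> inside the span of the
  \<open>m\<close> columns of \<open>Z\<close>; \<open>P * Z = Z\<close> puts these independent
  columns inside the range.\<close>

lemma rank_eqI:
  assumes P: "P \<in> carrier_mat n n" and Z: "Z \<in> carrier_mat n m" and Y: "Y \<in> carrier_mat m n"
    and PZY: "P = Z * Y" and PZ: "P * Z = Z"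
    and ind: "indep_rows {..<m} {..<n} (\<lambda>j i. Z $$ (i, j))"
  shows "vec_space.rank n P = m"
proof -
  interpret vec_space "TYPE(complex)" n .
  interpret S: coordinate_space "span_vs (set (cols P))" "{..<n}" "\<lambda>v i. v $ i"
    using coordinate_space_col_span[OF P] .
  have dim: "S.dim = rank P" by (simp add: rank_def)
  have sp: "span (set (cols P)) = {y \<in> carrier_vec n. \<exists>x\<in>carrier_vec n. P *\<^sub>v x = y}"
    using col_space_eq[OF P] P unfolding col_space_def by simp
  have "card {..<m} \<le> rank P" unfolding dim[symmetric]
  proof (rule S.card_le_dim[of _ "col Z"])
    fix l assume "l \<in> {..<m}"
    then have "P *\<^sub>v col Z l = col (P * Z) l" using Z P by (intro eq_vecI) auto
    then have "P *\<^sub>v col Z l = col Z l" using PZ by simp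
    moreover have "col Z l \<in> carrier_vec n" using Z by auto
    ultimately show "col Z l \<in> carrier (span_vs (set (cols P)))" using sp by auto
  next
    show "indep_rows {..<m} {..<n} (\<lambda>l i. col Z l $ i)"
      using ind Z by (subst indep_rows_cong[of _ _ _ "\<lambda>j i. Z $$ (i, j)"]) auto
  qed simp
  moreover have "rank P \<le> card {..<m}" unfolding dim[symmetric]
  proof (rule S.dim_le_card[of _ "\<lambda>j i. Z $$ (i, j)"])
    fix v assume "v \<in> carrier (span_vs (set (cols P)))"
    then obtain x where x: "x \<in> carrier_vec n" "v = P *\<^sub>v x" using sp by auto
    then have v: "v = Z *\<^sub>v (Y *\<^sub>v x)" using PZY Z Y by simp
    have "v $ i = (\<Sum>j<m. (Y *\<^sub>v x) $ j * Z $$ (i, j))" if "i < n" for i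
      unfolding v using that Z Y
      by (auto simp: scalar_prod_def mult.commute lessThan_atLeast0 intro!: sum.cong)
    then show "\<exists>c. \<forall>i\<in>{..<n}. v $ i = (\<Sum>j<m. c j * Z $$ (i, j))" by auto
  qed simp
  ultimately show ?thesis by simp
qed

subsection \<open>Full compressions of large subspaces\<close>

text \<open>
  Positions are ordered lexicographically, row first. A matrix of \<open>V\<close> vanishing at all leading
  positions is zero, so there are at least \<open>dim V\<close> of them.
\<close>
definition leading_positions :: "nat \<Rightarrow> complex mat set \<Rightarrow> (nat \<times> nat) set" where
  "leading_positions n V = {(r, c). r < n \<and> c < n \<and> (\<exists>A\<in>V. A $$ (r, c) \<noteq> 0 \<and>
     (\<forall>r'<r. \<forall>c'<n. A $$ (r', c') = 0) \<and> (\<forall>c'<c. A $$ (r, c') = 0))}"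

lemma leading_positions_subset: "leading_positions n V \<subseteq> positions n"
  by (auto simp: leading_positions_def)

lemma cdim_le_card_leading_positions:
  assumes "mat_subspace n V"
  shows "cdim n V \<le> card (leading_positions n V)"
proof (rule cdim_le_card_functionals[OF assms, of _ "\<lambda>q p. if p = q then 1 else 0"])
  show "finite (leading_positions n V)"
    using leading_positions_subset by (rule finite_subset) simp
  fix A i j
  assume A: "A \<in> V" "i < n" "j < n"
    and z: "\<And>q. q \<in> leading_positions n V \<Longrightarrow> (\<Sum>p\<in>positions n. (if p = q then 1 else 0) * A $$ p) = 0"
  have zero: "A $$ q = 0" if "q \<in> leading_positions n V" for q
  proof -
    have "q \<in> positions n" using that leading_positions_subset by blast
    then show ?thesis using z[OF that] sum_unit_functional[of "positions n" q] by simp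
  qed
  show "A $$ (i, j) = 0"
  proof (rule ccontr)
    assume nz: "A $$ (i, j) \<noteq> 0"
    \<comment> \<open>The lexicographically first nonzero position of \<open>A\<close> is leading,
      with \<open>A\<close> itself as witness, although \<open>A\<close> vanishes at all leading
      positions.\<close>
    define r where "r = (LEAST r. \<exists>c<n. A $$ (r, c) \<noteq> 0)"
    have r: "\<exists>c<n. A $$ (r, c) \<noteq> 0" unfolding r_def by (rule LeastI[of _ i]) (use nz A in blast)
    have rmin: "A $$ (r', c') = 0" if "r' < r" "c' < n" for r' c'
      using not_less_Least[of r' "\<lambda>r. \<exists>c<n. A $$ (r, c) \<noteq> 0"] that unfolding r_def by blast
    define c where "c = (LEAST c. c < n \<and> A $$ (r, c) \<noteq> 0)"
    have c: "c < n \<and> A $$ (r, c) \<noteq> 0"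
      unfolding c_def by (rule LeastI_ex) (use r in blast)
    have cmin: "A $$ (r, c') = 0" if "c' < c" for c'
      using not_less_Least[of c' "\<lambda>c. c < n \<and> A $$ (r, c) \<noteq> 0"] that c unfolding c_def by fastforce
    have "r \<le> i" using rmin[of i j] nz A by (meson not_less)
    then have "(r, c) \<in> leading_positions n V"
      using A c rmin cmin unfolding leading_positions_def by auto
    then show False using zero c by blast
  qed
qed

text \<open>With fewer than \<open>m\<close> rich rows, these contribute at most
  \<open>(m - 1) * n\<close> and the others at most \<open>m - 1\<close> each. Crediting
  \<open>m - 1\<close> to every row keeps the estimate uniform and still leaves the total below
  \<open>2 * m * n\<close>.\<close>

lemma rich_rows:
  assumes S: "S \<subseteq> positions n" and big: "2 * m * n \<le> card S" and "0 < n" "0 < m"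
  obtains R where "R \<subseteq> {..<n}" "card R = m" "\<And>r. r \<in> R \<Longrightarrow> m \<le> card {c. (r, c) \<in> S}"
proof -
  define T where "T = {r. r < n \<and> m \<le> card {c. (r, c) \<in> S}}"
  have T: "finite T" "T \<subseteq> {..<n}" by (auto simp: T_def)
  have "m \<le> card T"
  proof (rule ccontr)
    assume "\<not> m \<le> card T"
    then have cT: "card T \<le> m - 1" by simp
    have row: "card {c. (r, c) \<in> S} \<le> (if r \<in> T then n else 0) + (m - 1)" if "r < n" for r
    proof (cases "r \<in> T")
      case True
      have "card {c. (r, c) \<in> S} \<le> card {..<n}" using S by (intro card_mono) auto
      then show ?thesis using True by simp
    qed (use that in \<open>auto simp: T_def\<close>)
    have "S = (SIGMA r:{..<n}. {c. (r, c) \<in> S})" using S by auto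
    moreover have "finite {c. (r, c) \<in> S}" for r
      by (rule finite_subset[of _ "{..<n}"]) (use S in auto)
    ultimately have "card S = (\<Sum>r<n. card {c. (r, c) \<in> S})"
      using card_SigmaI[of "{..<n}" "\<lambda>r. {c. (r, c) \<in> S}"] by simp
    also have "\<dots> \<le> (\<Sum>r<n. (if r \<in> T then n else 0) + (m - 1))" using row by (intro sum_mono) auto
    also have "\<dots> = card T * n + n * (m - 1)"
      using T(2) by (simp add: sum.distrib sum.If_cases Int_absorb1)
    also have "\<dots> \<le> (m - 1) * n + n * (m - 1)" using cT by simp
    also have "\<dots> < 2 * m * n" using assms(3,4) by (cases m) auto
    finally show False using big by simp
  qed
  then obtain R where "R \<subseteq> T" "card R = m" using obtain_subset_with_card_n by metis
  then show ?thesis using that[of R] T(2) unfolding T_def by blast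
qed

text \<open>Let \<open>x\<close> select the columns in \<open>C\<close>. The resulting square family
  is triangular with the nonzero entries \<open>F q q\<close> on its diagonal.\<close>

lemma good_columns_for_row:
  fixes F :: "nat \<Rightarrow> nat \<Rightarrow> complex"
  assumes C: "C \<subseteq> {..<n}" "card C = m"
    and lead: "\<And>q. q \<in> C \<Longrightarrow> F q q \<noteq> 0" "\<And>q c. q \<in> C \<Longrightarrow> c < q \<Longrightarrow> F q c = 0"
  shows "\<exists>x. indep_rows C {..<m} (\<lambda>q j. \<Sum>c<n. F q c * x c j)"
proof -
  have fC: "finite C" using C(1) finite_subset by blast
  obtain \<kappa> where \<kappa>: "bij_betw \<kappa> {..<m} C"
    using ex_bij_betw_nat_finite[OF fC] C(2) by (metis lessThan_atLeast0)
  define x where "x = (\<lambda>c j. if c = \<kappa> j then 1 else 0 :: complex)"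
  have sx: "(\<Sum>c<n. F q c * x c j) = F q (\<kappa> j)" if "j < m" for q j
  proof -
    have "\<kappa> j \<in> {..<n}" using bij_betwE[OF \<kappa>] C(1) that by blast
    then have "(\<Sum>c<n. (if c = \<kappa> j then 1 else 0) * F q c) = F q (\<kappa> j)"
      by (intro sum_unit_functional) auto
    then show ?thesis unfolding x_def by (simp add: mult.commute)
  qed
  have "indep_rows C {..<m} (\<lambda>q j. \<Sum>c<n. F q c * x c j)"
  proof (rule indep_rowsI)
    fix d q
    assume d: "\<And>j. j \<in> {..<m} \<Longrightarrow> (\<Sum>q\<in>C. d q * (\<Sum>c<n. F q c * x c j)) = 0" and q: "q \<in> C"
    have d': "(\<Sum>q\<in>C. d q * F q p) = 0" if "p \<in> C" for p
    proof -
      obtain j where "j < m" "p = \<kappa> j" using bij_betw_imp_surj_on[OF \<kappa>] \<open>p \<in> C\<close> by auto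
      then show ?thesis using d[of j] sx by simp
    qed
    \<comment> \<open>In column \<open>p\<close>, the terms with \<open>q > p\<close> vanish because
      \<open>q\<close> is the first nonzero column of \<open>F q\<close>, and those with
      \<open>q < p\<close> by induction.\<close>
    show "d q = 0" using q
    proof (induction q rule: less_induct)
      case (less p)
      have "(\<Sum>q\<in>C - {p}. d q * F q p) = 0"
        using less lead(2) by (intro sum.neutral) (metis DiffE insertI1 mult_eq_0_iff nat_neq_iff)
      then have "d p * F p p = 0" using d'[OF less.prems] sum.remove[OF fC less.prems, of "\<lambda>q. d q * F q p"] by simp
      then show ?case using lead(1)[OF less.prems] by simp
    qed
  qed
  then show ?thesis by blast
qed

text \<open>
  Solutions are joined by lines: on the line through \<open>x\<close> and \<open>y\<close>, all but finitely many
  points inherit the (open) condition of either end.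
\<close>
lemma common_parameter:
  fixes P :: "'s \<Rightarrow> (nat \<Rightarrow> nat \<Rightarrow> complex) \<Rightarrow> bool"
  assumes "finite R" "\<And>s. s \<in> R \<Longrightarrow> \<exists>x. P s x"
    and line: "\<And>s x y. s \<in> R \<Longrightarrow> P s x \<or> P s y \<Longrightarrow>
      finite {t. \<not> P s (\<lambda>c j. x c j + t * (y c j - x c j))}"
  shows "\<exists>x. \<forall>s\<in>R. P s x"
  using assms
proof (induction R rule: finite_induct)
  case empty
  then show ?case by simp
next
  case (insert r R)
  obtain x where x: "\<forall>s\<in>R. P s x" using insert.IH insert.prems by blast
  obtain y where y: "P r y" using insert.prems(1) by blast
  let ?z = "\<lambda>t c j. x c j + t * (y c j - x c j)"
  have "finite (\<Union>s\<in>insert r R. {t. \<not> P s (?z t)})"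
    using insert.hyps x y by (intro finite_UN_I insert.prems(2)) auto
  then obtain t where "t \<notin> (\<Union>s\<in>insert r R. {t. \<not> P s (?z t)})"
    using ex_new_if_finite[OF infinite_UNIV_char_0] by blast
  then show ?case by (intro exI[of _ "?z t"]) auto
qed

text \<open>The \<open>(i, j)\<close> entry of \<open>Y F_l X\<close>. The left factor is stored
  transposed, so that \<open>Y = X^*\<close> becomes the entrywise relation
  \<open>y r i = cnj (x r i)\<close>.\<close>

definition compressed :: "nat \<Rightarrow> ('l \<Rightarrow> nat \<Rightarrow> nat \<Rightarrow> complex) \<Rightarrow> (nat \<Rightarrow> nat \<Rightarrow> complex) \<Rightarrow>
    (nat \<Rightarrow> nat \<Rightarrow> complex) \<Rightarrow> 'l \<Rightarrow> nat \<times> nat \<Rightarrow> complex" where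
  "compressed n F y x l = (\<lambda>(i, j). \<Sum>r<n. \<Sum>c<n. y r i * F l r c * x c j)"

text \<open>Let \<open>y\<close> select the rows in \<open>R\<close>. Because
  \<open>F (s, q)\<close> vanishes above row \<open>s\<close>, the square family is block
  triangular, with one diagonal block for each row of \<open>R\<close>.\<close>

lemma exists_two_sided_compression:
  fixes F :: "nat \<times> nat \<Rightarrow> nat \<Rightarrow> nat \<Rightarrow> complex"
  assumes R: "R \<subseteq> {..<n}" "card R = m"
    and C: "\<And>s. s \<in> R \<Longrightarrow> C s \<subseteq> {..<n}" "\<And>s. s \<in> R \<Longrightarrow> card (C s) = m"
    and lead: "\<And>s q. s \<in> R \<Longrightarrow> q \<in> C s \<Longrightarrow> F (s, q) s q \<noteq> 0"
      "\<And>s q c. s \<in> R \<Longrightarrow> q \<in> C s \<Longrightarrow> c < q \<Longrightarrow> F (s, q) s c = 0"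
      "\<And>s q r c. s \<in> R \<Longrightarrow> q \<in> C s \<Longrightarrow> r < s \<Longrightarrow> c < n \<Longrightarrow> F (s, q) r c = 0"
  shows "\<exists>y x. indep_rows (Sigma R C) (positions m) (compressed n F y x)"
proof -
  have fR: "finite R" and fC: "\<And>s. s \<in> R \<Longrightarrow> finite (C s)"
    using R C(1) finite_subset by blast+
  \<comment> \<open>\<open>?P s x\<close> says that the diagonal block of row \<open>s\<close> is
    nonsingular. The columns that suit one row need not suit another, hence the passage to a generic
    \<open>x\<close>.\<close>
  let ?P = "\<lambda>s x. indep_rows (C s) {..<m} (\<lambda>q j. \<Sum>c<n. F (s, q) s c * x c j)"
  have "\<exists>x. \<forall>s\<in>R. ?P s x"
  proof (rule common_parameter[OF fR])
    show "\<exists>x. ?P s x" if "s \<in> R" for s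
      using good_columns_for_row[OF C(1,2)[OF that], of "\<lambda>q. F (s, q) s"] lead that by blast
    fix s and x y :: "nat \<Rightarrow> nat \<Rightarrow> complex" assume s: "s \<in> R" and xy: "?P s x \<or> ?P s y"
    obtain t0 where "?P s (\<lambda>c j. x c j + t0 * (y c j - x c j))"
      using xy
    proof
      assume "?P s x" then show ?thesis by (intro that[of 0]) simp
    next
      assume "?P s y" then show ?thesis by (intro that[of 1]) simp
    qed
    then show "finite {t. \<not> ?P s (\<lambda>c j. x c j + t * (y c j - x c j))}"
      using fC[OF s] C(2)[OF s]
      by (intro finite_degenerate_parameters range_poly_intros) auto
  qed
  then obtain x where x: "\<And>s. s \<in> R \<Longrightarrow> ?P s x" by blast
  obtain \<rho> where \<rho>: "bij_betw \<rho> {..<m} R"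
    using ex_bij_betw_nat_finite[OF fR] R(2) by (metis lessThan_atLeast0)
  define y where "y = (\<lambda>r i. if r = \<rho> i then 1 else 0 :: complex)"
  have comp: "compressed n F y x l (i, j) = (\<Sum>c<n. F l (\<rho> i) c * x c j)" if "i < m" for l i j
  proof -
    have "\<rho> i \<in> {..<n}" using bij_betwE[OF \<rho>] R(1) that by blast
    have "compressed n F y x l (i, j) = (\<Sum>r<n. (if r = \<rho> i then 1 else 0) * (\<Sum>c<n. F l r c * x c j))"
      by (simp add: compressed_def y_def sum_distrib_left mult.assoc)
    also have "\<dots> = (\<Sum>c<n. F l (\<rho> i) c * x c j)"
      using \<open>\<rho> i \<in> {..<n}\<close> by (intro sum_unit_functional) auto
    finally show ?thesis .
  qed
  have "indep_rows (Sigma R C) (positions m) (compressed n F y x)"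
  proof (rule indep_rowsI)
    fix d l
    assume d: "\<And>p. p \<in> positions m \<Longrightarrow> (\<Sum>l\<in>Sigma R C. d l * compressed n F y x l p) = 0"
      and l: "l \<in> Sigma R C"
    define g where "g l r j = (\<Sum>c<n. F l r c * x c j)" for l r j
    have d': "(\<Sum>s\<in>R. \<Sum>q\<in>C s. d (s, q) * g (s, q) r j) = 0" if "r \<in> R" "j < m" for r j
    proof -
      obtain i where i: "i < m" "r = \<rho> i" using bij_betw_imp_surj_on[OF \<rho>] \<open>r \<in> R\<close> by auto
      have "(\<Sum>s\<in>R. \<Sum>q\<in>C s. d (s, q) * g (s, q) r j) = (\<Sum>l\<in>Sigma R C. d l * g l r j)"
        using fR fC by (subst sum.Sigma) (auto simp: case_prod_unfold)
      also have "\<dots> = (\<Sum>l\<in>Sigma R C. d l * compressed n F y x l (i, j))"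
        unfolding g_def i(2) by (simp add: comp[OF i(1)])
      finally show ?thesis using d[of "(i, j)"] i that by simp
    qed
    have g0: "g (s, q) r j = 0" if "s \<in> R" "q \<in> C s" "r < s" for s q r j
      unfolding g_def using lead(3)[OF that] by simp
    \<comment> \<open>On row \<open>r\<close>, matrices with pivot row \<open>s > r\<close> vanish,
      those with \<open>s < r\<close> have lost their coefficients by induction, and the remaining
      block is nonsingular by the choice of \<open>x\<close>.\<close>
    have "\<forall>q\<in>C r. d (r, q) = 0" if "r \<in> R" for r using that
    proof (induction r rule: less_induct)
      case (less r)
      have "(\<Sum>q\<in>C s. d (s, q) * g (s, q) r j) = 0" if "s \<in> R - {r}" for s j
      proof (intro sum.neutral ballI)
        fix q assume q: "q \<in> C s"
        consider "s < r" | "r < s" using \<open>s \<in> R - {r}\<close> by fastforce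
        then show "d (s, q) * g (s, q) r j = 0"
          using less.IH[of s] g0[of s q r j] that q by cases auto
      qed
      then have "(\<Sum>s\<in>R - {r}. \<Sum>q\<in>C s. d (s, q) * g (s, q) r j) = 0" for j
        by (intro sum.neutral) blast
      then have "(\<Sum>q\<in>C r. d (r, q) * g (r, q) r j) = 0" if "j < m" for j
        using d'[OF less.prems that] sum.remove[OF fR less.prems, of "\<lambda>s. \<Sum>q\<in>C s. d (s, q) * g (s, q) r j"]
        by simp
      then show ?case
        unfolding g_def by (intro ballI indep_rowsD[OF x[OF less.prems], of "\<lambda>q. d (r, q)"]) auto
    qed
    then show "d l = 0" using l by auto
  qed
  then show ?thesis by blast
qed

section \<open>From two-sided to Hermitian compressions\<close>

lemma exists_real_parameter:
  assumes "finite {t :: complex. \<not> Q t}"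
  shows "\<exists>t :: real. Q (of_real t)"
proof (rule ccontr)
  assume "\<not> (\<exists>t :: real. Q (of_real t))"
  then have "range (of_real :: real \<Rightarrow> complex) \<subseteq> {t. \<not> Q t}" by auto
  then have "finite (range (of_real :: real \<Rightarrow> complex))" using assms finite_subset by blast
  then have "finite (UNIV :: real set)" by (rule finite_imageD) (simp add: inj_on_def)
  then show False using infinite_UNIV_char_0 by blast
qed

text \<open>
  The independent vectors \<open>x\<close> and \<open>y\<close> are replaced by \<open>z\<close> and its conjugate: the pair
  \<open>(s p + t q, s cnj p + t cnj q)\<close> equals \<open>(x, y)\<close> at \<open>(s, t) = (1, \<i>)\<close> and is a conjugate
  pair for real \<open>s\<close> and \<open>t\<close>. Nondegeneracy is polynomial in each parameter, so each can
  be made real in turn.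
\<close>
lemma exists_hermitian_compression:
  fixes F :: "'l \<Rightarrow> nat \<Rightarrow> nat \<Rightarrow> complex"
  assumes I: "finite I" "card I = card (positions m)"
    and ind: "indep_rows I (positions m) (compressed n F y x)"
  shows "\<exists>z. indep_rows I (positions m) (compressed n F (\<lambda>r i. cnj (z r i)) z)"
proof -
  define p where "p r j = (x r j + cnj (y r j)) / 2" for r j
  define q where "q r j = (x r j - cnj (y r j)) / (2 * \<i>)" for r j
  define X where "X s t = (\<lambda>r j. s * p r j + t * q r j)" for s t
  \<comment> \<open>The parameters enter \<open>Y\<close> without conjugation, so all entries stay
    polynomial in \<open>s\<close> and in \<open>t\<close>.\<close>
  define Y where "Y s t = (\<lambda>r j. s * cnj (p r j) + t * cnj (q r j))" for s t
  let ?Q = "\<lambda>s t. indep_rows I (positions m) (compressed n F (Y s t) (X s t))"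
  have poly_s: "(\<lambda>s. compressed n F (Y s t) (X s t) l e) \<in> range poly"
    and poly_t: "(\<lambda>t. compressed n F (Y s t) (X s t) l e) \<in> range poly" for s t l e
    unfolding compressed_def X_def Y_def case_prod_unfold by (intro range_poly_intros)+
  have "X 1 \<i> = x" "Y 1 \<i> = y"
    unfolding X_def Y_def p_def q_def by (auto simp: field_simps intro!: ext)
  then have "?Q 1 \<i>" using ind by simp
  then have "finite {s. \<not> ?Q s \<i>}"
    using I by (intro finite_degenerate_parameters poly_s) auto
  then obtain s :: real where "?Q s \<i>" using exists_real_parameter[of "\<lambda>s. ?Q s \<i>"] by blast
  then have "finite {t. \<not> ?Q s t}"
    using I by (intro finite_degenerate_parameters[where a = "\<lambda>t. compressed n F (Y s t) (X s t)"] poly_t) auto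
  then obtain t :: real where t: "?Q s t" using exists_real_parameter[of "?Q s"] by blast
  have "Y s t = (\<lambda>r i. cnj (X s t r i))" unfolding X_def Y_def by simp
  then show ?thesis using t by (intro exI[of _ "X s t"]) simp
qed

text \<open>In each of \<open>m\<close> rich rows, \<open>m\<close> leading positions are kept, each
  with a matrix of \<open>V\<close> that starts there. The index set \<open>I\<close> consists of
  these \<open>m^2\<close> positions.\<close>

lemma exists_full_compression:
  assumes V: "mat_subspace n V" and big: "2 * m * n \<le> cdim n V" and "0 < n" "0 < m"
  obtains I :: "(nat \<times> nat) set" and A z where "finite I" "card I = m\<^sup>2" "\<And>l. l \<in> I \<Longrightarrow> A l \<in> V"
    "indep_rows I (positions m) (compressed n (\<lambda>l r c. A l $$ (r, c)) (\<lambda>r i. cnj (z r i)) z)"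
proof -
  let ?S = "leading_positions n V"
  have "2 * m * n \<le> card ?S" using cdim_le_card_leading_positions[OF V] big by linarith
  then obtain R where R: "R \<subseteq> {..<n}" "card R = m" "\<And>r. r \<in> R \<Longrightarrow> m \<le> card {c. (r, c) \<in> ?S}"
    using rich_rows[OF leading_positions_subset] assms(3,4) by metis
  have "\<exists>D. D \<subseteq> {c. (r, c) \<in> ?S} \<and> card D = m" if "r \<in> R" for r
    using obtain_subset_with_card_n[OF R(3)[OF that]] by blast
  then obtain C where C: "\<And>r. r \<in> R \<Longrightarrow> C r \<subseteq> {c. (r, c) \<in> ?S}" "\<And>r. r \<in> R \<Longrightarrow> card (C r) = m"
    by metis
  define Q where "Q l A \<longleftrightarrow> A \<in> V \<and> A $$ l \<noteq> 0 \<and> (\<forall>r'<fst l. \<forall>c'<n. A $$ (r', c') = 0) \<and>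
    (\<forall>c'<snd l. A $$ (fst l, c') = 0)" for l A
  have "\<exists>A. Q l A" if "l \<in> ?S" for l
    using that unfolding leading_positions_def Q_def by auto
  then obtain A where "\<And>l. l \<in> ?S \<Longrightarrow> Q l (A l)" by metis
  then have "Q (r, c) (A (r, c))" if "r \<in> R" "c \<in> C r" for r c using C(1) that by blast
  then have A: "A (r, c) \<in> V" "A (r, c) $$ (r, c) \<noteq> 0"
    "\<And>r' c'. r' < r \<Longrightarrow> c' < n \<Longrightarrow> A (r, c) $$ (r', c') = 0"
    "\<And>c'. c' < c \<Longrightarrow> A (r, c) $$ (r, c') = 0" if "r \<in> R" "c \<in> C r" for r c
    using that by (auto simp: Q_def)
  have Cn: "C r \<subseteq> {..<n}" if "r \<in> R" for r using C(1)[OF that] leading_positions_subset by blast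
  have fR: "finite R" using R(1) finite_subset by blast
  have fC: "finite (C r)" if "r \<in> R" for r using Cn[OF that] finite_subset by blast
  have "\<exists>y x. indep_rows (Sigma R C) (positions m) (compressed n (\<lambda>l r c. A l $$ (r, c)) y x)"
    by (rule exists_two_sided_compression[OF R(1,2) Cn C(2)]) (use A in auto)
  moreover have card: "card (Sigma R C) = m\<^sup>2"
    using fR fC C(2) R(2) by (subst card_SigmaI) (auto simp: power2_eq_square)
  moreover have fS: "finite (Sigma R C)" using fR fC by blast
  ultimately obtain z where
    "indep_rows (Sigma R C) (positions m) (compressed n (\<lambda>l r c. A l $$ (r, c)) (\<lambda>r i. cnj (z r i)) z)"
    using exists_hermitian_compression[of "Sigma R C" m n "\<lambda>l r c. A l $$ (r, c)"]
    by (auto simp: card_cartesian_product power2_eq_square)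
  then show ?thesis using that[OF fS card, of A z] A by auto
qed

subsection \<open>From full compressions to cliques\<close>

lemma mat_adjoint_carrier [simp]: "A \<in> carrier_mat n m \<Longrightarrow> mat_adjoint A \<in> carrier_mat m n"
  unfolding mat_adjoint_def by auto

lemma mat_adjoint_dim [simp]:
  "dim_row (mat_adjoint A) = dim_col A" "dim_col (mat_adjoint A) = dim_row A"
  unfolding mat_adjoint_def by auto

lemma mat_adjoint_index [simp]:
  fixes A :: "complex mat"
  assumes "A \<in> carrier_mat n m" "i < m" "j < n"
  shows "mat_adjoint A $$ (i, j) = cnj (A $$ (j, i))"
  using assms unfolding mat_adjoint_def by (auto simp: mat_of_rows_index)

lemma mat_adjoint_mult:
  fixes A B :: "complex mat"
  assumes A: "A \<in> carrier_mat n m" and B: "B \<in> carrier_mat m k"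
  shows "mat_adjoint (A * B) = mat_adjoint B * mat_adjoint A"
proof (rule eq_matI)
  have AB: "A * B \<in> carrier_mat n k" using A B by simp
  fix i j assume "i < dim_row (mat_adjoint B * mat_adjoint A)" "j < dim_col (mat_adjoint B * mat_adjoint A)"
  then have ij: "i < k" "j < n"
    using mat_adjoint_carrier[OF A] mat_adjoint_carrier[OF B] by auto
  have "mat_adjoint (A * B) $$ (i, j) = cnj ((A * B) $$ (j, i))" using AB ij by simp
  also have "\<dots> = (\<Sum>l\<in>{0..<m}. cnj (A $$ (j, l)) * cnj (B $$ (l, i)))"
    using A B ij by (simp add: scalar_prod_def)
  also have "\<dots> = (\<Sum>l\<in>{0..<m}. mat_adjoint B $$ (i, l) * mat_adjoint A $$ (l, j))"
    using mat_adjoint_index[OF A] mat_adjoint_index[OF B] ij by (intro sum.cong) auto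
  also have "\<dots> = (mat_adjoint B * mat_adjoint A) $$ (i, j)"
    using A B ij by (simp add: scalar_prod_def)
  finally show "mat_adjoint (A * B) $$ (i, j) = (mat_adjoint B * mat_adjoint A) $$ (i, j)" .
qed (use mat_adjoint_carrier[OF A] mat_adjoint_carrier[OF B] mat_adjoint_carrier[of "A * B" n k] A B in auto)

lemma mat_adjoint_adjoint:
  fixes A :: "complex mat"
  assumes A: "A \<in> carrier_mat n m"
  shows "mat_adjoint (mat_adjoint A) = A"
  using A mat_adjoint_carrier[OF A] mat_adjoint_carrier[OF mat_adjoint_carrier[OF A]]
    mat_adjoint_index[OF mat_adjoint_carrier[OF A]] mat_adjoint_index[OF A]
  by (intro eq_matI) auto

lemma mat_adjoint_one [simp]: "mat_adjoint (1\<^sub>m n :: complex mat) = 1\<^sub>m n"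
proof (rule eq_matI)
  fix i j assume "i < dim_row (1\<^sub>m n :: complex mat)" "j < dim_col (1\<^sub>m n :: complex mat)"
  then show "mat_adjoint (1\<^sub>m n :: complex mat) $$ (i, j) = 1\<^sub>m n $$ (i, j)"
    using mat_adjoint_index[OF one_carrier_mat, of i n j] by simp
qed (use mat_adjoint_carrier[OF one_carrier_mat[of n, where 'a = complex]] in auto)

lemma triple_product_index:
  fixes X A Y :: "complex mat"
  assumes "X \<in> carrier_mat k n" "A \<in> carrier_mat n n" "Y \<in> carrier_mat n l" "i < k" "j < l"
  shows "(X * A * Y) $$ (i, j) = (\<Sum>r<n. \<Sum>c<n. X $$ (i, r) * A $$ (r, c) * Y $$ (c, j))"
proof -
  have "(X * A * Y) $$ (i, j) = (\<Sum>c<n. (\<Sum>r<n. X $$ (i, r) * A $$ (r, c)) * Y $$ (c, j))"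
    using assms by (simp add: scalar_prod_def lessThan_atLeast0 del: assoc_mult_mat)
  also have "\<dots> = (\<Sum>c<n. \<Sum>r<n. X $$ (i, r) * A $$ (r, c) * Y $$ (c, j))"
    by (simp add: sum_distrib_right)
  finally show ?thesis by (subst (asm) sum.swap)
qed

lemma obtain_inverse_mat:
  fixes G :: "complex mat"
  assumes "G \<in> carrier_mat m m" "det G \<noteq> 0"
  obtains H where "H \<in> carrier_mat m m" "H * G = 1\<^sub>m m" "G * H = 1\<^sub>m m"
  using det_non_zero_imp_unit[OF assms, of "()"] unfolding Units_def
  by (auto simp: ring_mat_simps)

lemma mat_subspace_compress:
  assumes V: "mat_subspace n V" and P: "P \<in> carrier_mat n n"
  shows "mat_subspace n {P * A * P | A. A \<in> V}"
proof (rule mat_subspaceI)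
  note Vc = mat_subspaceD(1)[OF V]
  show "{P * A * P | A. A \<in> V} \<subseteq> carrier_mat n n" using Vc P by auto
  have "P * 0\<^sub>m n n * P = 0\<^sub>m n n" using P by simp
  then show "0\<^sub>m n n \<in> {P * A * P | A. A \<in> V}" using mat_subspaceD(2)[OF V]
    by (metis (mono_tags, lifting) mem_Collect_eq)
next
  fix B C assume "B \<in> {P * A * P | A. A \<in> V}" "C \<in> {P * A * P | A. A \<in> V}"
  then obtain A A' where A: "A \<in> V" "A' \<in> V" "B = P * A * P" "C = P * A' * P" by blast
  then have "A \<in> carrier_mat n n" "A' \<in> carrier_mat n n" using mat_subspaceD(1)[OF V] by auto
  then have "B + C = P * (A + A') * P"
    unfolding A(3,4) using P by (simp add: mult_add_distrib_mat add_mult_distrib_mat[of _ n n])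
  then show "B + C \<in> {P * A * P | A. A \<in> V}" using mat_subspaceD(3)[OF V A(1,2)] by blast
next
  fix c B assume "B \<in> {P * A * P | A. A \<in> V}"
  then obtain A where A: "A \<in> V" "B = P * A * P" by blast
  then have "A \<in> carrier_mat n n" using mat_subspaceD(1)[OF V] by auto
  then have "c \<cdot>\<^sub>m B = P * (c \<cdot>\<^sub>m A) * P"
    unfolding A(2) using P by (simp add: mult_smult_distrib mult_smult_assoc_mat[of _ n n])
  then show "c \<cdot>\<^sub>m B \<in> {P * A * P | A. A \<in> V}" using mat_subspaceD(4)[OF V A(1)] by blast
qed

text \<open>Allows \<open>Y * B * Z\<close> to serve as coordinates of the compression
  \<open>P * B * P\<close>.\<close>

lemma compression_absorb:
  fixes Y P B Z :: "complex mat"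
  assumes Y: "Y \<in> carrier_mat m n" and P: "P \<in> carrier_mat n n" and B: "B \<in> carrier_mat n n"
    and Z: "Z \<in> carrier_mat n k" and YP: "Y * P = Y" and PZ: "P * Z = Z"
  shows "Y * (P * B * P) * Z = Y * B * Z"
proof -
  have PB: "P * B \<in> carrier_mat n n" and YB: "Y * B \<in> carrier_mat m n" using P B Y by auto
  have "Y * (P * B * P) = Y * B * P"
    using assoc_mult_mat[OF Y PB P] assoc_mult_mat[OF Y P B] YP by simp
  then show ?thesis using assoc_mult_mat[OF YB P Z] PZ by simp
qed

lemma projection_absorb:
  fixes P A :: "complex mat"
  assumes P: "P \<in> carrier_mat n n" "P * P = P" and A: "A \<in> carrier_mat n n"
  shows "P * (P * A * P) * P = P * A * P"
  by (rule compression_absorb[OF P(1) P(1) A P(1) P(2) P(2)])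

text \<open>A vector \<open>v\<close> killed by \<open>z\<close> is killed by every compressed
  matrix. Since these matrices span all \<open>m\<close> by \<open>m\<close> matrices,
  \<open>v = 0\<close>.\<close>

lemma indep_columns_of_compression:
  fixes F :: "'l \<Rightarrow> nat \<Rightarrow> nat \<Rightarrow> complex"
  assumes I: "finite I" "card I = card (positions m)"
    and ind: "indep_rows I (positions m) (compressed n F y z)"
  shows "indep_rows {..<m} {..<n} (\<lambda>j r. z r j)"
proof (rule indep_rowsI)
  fix v j
  assume v: "\<And>r. r \<in> {..<n} \<Longrightarrow> (\<Sum>j<m. v j * z r j) = 0" and j: "j \<in> {..<m}"
  have tr: "indep_rows (positions m) I (\<lambda>p l. compressed n F y z l p)"
    by (rule indep_rows_transpose[OF I(1) _ I(2) ind]) simp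
  \<comment> \<open>\<open>d\<close> represents the functional that sends a matrix \<open>M\<close>
    to entry \<open>j\<close> of \<open>M v\<close>. Using row \<open>j\<close> makes the
    coefficient at \<open>(j, j)\<close> equal to \<open>v j\<close>.\<close>
  define d where "d p = (if fst p = j then v (snd p) else 0)" for p
  have "(\<Sum>p\<in>positions m. d p * compressed n F y z l p) = 0" for l
  proof -
    have "(\<Sum>p\<in>positions m. d p * compressed n F y z l p) =
        (\<Sum>i<m. \<Sum>k<m. d (i, k) * compressed n F y z l (i, k))"
      by (subst sum.cartesian_product) (simp add: case_prod_unfold)
    also have "\<dots> = (\<Sum>i<m. if i = j then (\<Sum>k<m. v k * compressed n F y z l (j, k)) else 0)"
      by (intro sum.cong) (auto simp: d_def)
    also have "\<dots> = (\<Sum>k<m. v k * compressed n F y z l (j, k))" using j by simp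
    also have "\<dots> = (\<Sum>k<m. \<Sum>r<n. \<Sum>c<n. y r j * F l r c * (v k * z c k))"
      by (simp add: compressed_def sum_distrib_left mult_ac)
    also have "\<dots> = (\<Sum>r<n. \<Sum>k<m. \<Sum>c<n. y r j * F l r c * (v k * z c k))" by (rule sum.swap)
    also have "\<dots> = (\<Sum>r<n. \<Sum>c<n. \<Sum>k<m. y r j * F l r c * (v k * z c k))"
      by (intro sum.cong refl sum.swap)
    also have "\<dots> = (\<Sum>r<n. \<Sum>c<n. y r j * F l r c * (\<Sum>k<m. v k * z c k))"
      by (simp add: sum_distrib_left)
    also have "\<dots> = 0" using v by simp
    finally show ?thesis .
  qed
  then have "d (j, j) = 0" using j by (intro indep_rowsD[OF tr, of d "(j, j)"]) blast+
  then show "v j = 0" by (simp add: d_def)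
qed

text \<open>If \<open>Z^* Z v = 0\<close>, then the squared norm of \<open>Z v\<close> is
  \<open>v^* Z^* Z v = 0\<close>, so \<open>Z v = 0\<close> and independence of the columns gives
  \<open>v = 0\<close>.\<close>

lemma det_gram_nonzero:
  assumes Z: "Z \<in> carrier_mat n m"
    and ind: "indep_rows {..<m} {..<n} (\<lambda>j r. Z $$ (r, j))"
  shows "det (mat_adjoint Z * Z) \<noteq> 0"
proof
  note Zh = mat_adjoint_carrier[OF Z]
  assume "det (mat_adjoint Z * Z) = 0"
  then obtain v where v: "v \<in> carrier_vec m" "v \<noteq> 0\<^sub>v m" "(mat_adjoint Z * Z) *\<^sub>v v = 0\<^sub>v m"
    using det_0_iff_vec_prod_zero[OF mult_carrier_mat[OF Zh Z]] by blast
  define u where "u r = (\<Sum>j<m. v $ j * Z $$ (r, j))" for r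
  have Zv: "(Z *\<^sub>v v) $ r = u r" if "r < n" for r
    using that v(1) Z by (auto simp: u_def scalar_prod_def lessThan_atLeast0 mult.commute intro!: sum.cong)
  have "mat_adjoint Z *\<^sub>v (Z *\<^sub>v v) = 0\<^sub>v m" using v(1,3) Z Zh by simp
  moreover have "(mat_adjoint Z *\<^sub>v (Z *\<^sub>v v)) $ i = (\<Sum>r<n. cnj (Z $$ (r, i)) * u r)" if "i < m" for i
    using that Z Zh v(1) Zv mat_adjoint_index[OF Z]
    by (auto simp: scalar_prod_def lessThan_atLeast0 simp del: index_mult_mat_vec
      simp: index_mult_mat_vec[of i "mat_adjoint Z"] intro!: sum.cong)
  ultimately have orth: "(\<Sum>r<n. cnj (Z $$ (r, i)) * u r) = 0" if "i < m" for i using that by simp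
  have "(\<Sum>r<n. cnj (u r) * u r) = (\<Sum>r<n. \<Sum>i<m. cnj (v $ i) * (cnj (Z $$ (r, i)) * u r))"
    by (simp add: u_def[of _] sum_distrib_right mult.assoc)
  also have "\<dots> = (\<Sum>i<m. cnj (v $ i) * (\<Sum>r<n. cnj (Z $$ (r, i)) * u r))"
    by (subst sum.swap) (simp add: sum_distrib_left)
  also have "\<dots> = 0" using orth by simp
  finally have "(\<Sum>r<n. cnj (u r) * u r) = 0" .
  moreover have "(\<Sum>r<n. cnj (u r) * u r) = of_real (\<Sum>r<n. (cmod (u r))\<^sup>2)"
    by (simp add: complex_norm_square mult.commute del: of_real_power)
  ultimately have "(\<Sum>r<n. (cmod (u r))\<^sup>2) = 0" using of_real_eq_0_iff by metis
  then have "u r = 0" if "r < n" for r using that by (subst (asm) sum_nonneg_eq_0_iff) auto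
  then have "v $ j = 0" if "j < m" for j
    using that unfolding u_def by (intro indep_rowsD[OF ind, of "\<lambda>j. v $ j"]) auto
  then have "v = 0\<^sub>v m" using v(1) by (intro eq_vecI) auto
  then show False using v(2) by simp
qed

text \<open>\<open>P = Z (Z^* Z)^{-1} Z^*\<close> is the orthogonal projection onto the range of
  \<open>Z\<close>. On \<open>P V P\<close> the map from \<open>B\<close> to \<open>Y B Z\<close> is
  injective, since \<open>B = Z H (Y B Z) H Y\<close>; and \<open>Y P A P Z = Y A Z\<close>, so by
  \<open>ind\<close> its image contains \<open>m^2\<close> independent matrices.\<close>

lemma quantum_clique_of_compression:
  assumes V: "mat_subspace n V" and I: "finite I" "card I = m\<^sup>2" and AV: "\<And>l. l \<in> I \<Longrightarrow> A l \<in> V"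
    and ind: "indep_rows I (positions m) (compressed n (\<lambda>l r c. A l $$ (r, c)) (\<lambda>r i. cnj (z r i)) z)"
  shows "\<exists>P. quantum_clique n m V P"
proof -
  have cI: "card I = card (positions m)" using I(2) by (simp add: card_cartesian_product power2_eq_square)
  define Z where "Z = mat n m (\<lambda>(r, i). z r i)"
  define Y where "Y = mat_adjoint Z"
  have Z: "Z \<in> carrier_mat n m" and Zi: "\<And>r i. r < n \<Longrightarrow> i < m \<Longrightarrow> Z $$ (r, i) = z r i"
    by (auto simp: Z_def)
  have Y: "Y \<in> carrier_mat m n" and Yi: "\<And>r i. r < n \<Longrightarrow> i < m \<Longrightarrow> Y $$ (i, r) = cnj (z r i)"
    using Z Zi by (auto simp: Y_def)
  have indZ: "indep_rows {..<m} {..<n} (\<lambda>j r. Z $$ (r, j))"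
    using indep_columns_of_compression[OF I(1) cI ind] Zi
    by (subst indep_rows_cong[of _ _ _ "\<lambda>j r. z r j"]) auto
  have G: "Y * Z \<in> carrier_mat m m" using Y Z by simp
  obtain H where H: "H \<in> carrier_mat m m" "H * (Y * Z) = 1\<^sub>m m" "(Y * Z) * H = 1\<^sub>m m"
    using obtain_inverse_mat[OF G] det_gram_nonzero[OF Z indZ] unfolding Y_def by blast
  have adjY: "mat_adjoint Y = Z" unfolding Y_def by (rule mat_adjoint_adjoint[OF Z])
  have adjG: "mat_adjoint (Y * Z) = Y * Z"
    by (simp add: mat_adjoint_mult[OF Y Z] adjY Y_def[symmetric])
  have adjH: "mat_adjoint H = H"
  proof -
    \<comment> \<open>The adjoint of the right inverse is a left inverse because the Gram matrix
      \<open>Y * Z\<close> is Hermitian; inverses being unique, \<open>H\<close> is Hermitian as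
      well.\<close>
    have "mat_adjoint H * (Y * Z) = 1\<^sub>m m"
      using mat_adjoint_mult[OF G H(1)] H(3) adjG by simp
    then have "(mat_adjoint H * (Y * Z)) * H = H" using H(1) by simp
    moreover have "(mat_adjoint H * (Y * Z)) * H = mat_adjoint H * ((Y * Z) * H)"
      using mat_adjoint_carrier[OF H(1)] G H(1) by (rule assoc_mult_mat)
    ultimately show ?thesis using H(3) right_mult_one_mat[OF mat_adjoint_carrier[OF H(1)]] by simp
  qed
  define P where "P = Z * (H * Y)"
  have HY: "H * Y \<in> carrier_mat m n" using H Y by simp
  have P: "P \<in> carrier_mat n n" using Z HY by (simp add: P_def)
  have PZ: "P * Z = Z"
  proof -
    have "P * Z = Z * ((H * Y) * Z)" unfolding P_def using Z HY Z by (rule assoc_mult_mat)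
    also have "(H * Y) * Z = H * (Y * Z)" using H(1) Y Z by (rule assoc_mult_mat)
    finally show ?thesis using H(2) Z by simp
  qed
  have PP: "P * P = P"
  proof -
    have "P * P = (P * Z) * (H * Y)"
      using assoc_mult_mat[OF P Z HY] by (simp add: P_def[symmetric])
    then show ?thesis using PZ by (simp add: P_def)
  qed
  have adjP: "mat_adjoint P = P"
  proof -
    have "mat_adjoint P = mat_adjoint (H * Y) * Y"
      unfolding P_def by (simp add: mat_adjoint_mult[OF Z HY] Y_def[symmetric])
    also have "\<dots> = Z * H * Y" by (simp add: mat_adjoint_mult[OF H(1) Y] adjY adjH)
    also have "\<dots> = P" unfolding P_def using Z H(1) Y by (rule assoc_mult_mat)
    finally show ?thesis .
  qed
  have YP: "Y * P = Y"
    using mat_adjoint_mult[OF P Z] PZ adjP by (simp add: Y_def)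
  have rank: "vec_space.rank n P = m"
    by (rule rank_eqI[OF P Z HY P_def PZ indZ])
  let ?W = "{P * A * P | A. A \<in> V}"
  have W: "mat_subspace n ?W" by (rule mat_subspace_compress[OF V P])
  have Vc: "V \<subseteq> carrier_mat n n" by (rule mat_subspaceD(1)[OF V])
  have form: "(Y * B * Z) $$ (i, j) = (\<Sum>r<n. \<Sum>c<n. cnj (z r i) * B $$ (r, c) * z c j)"
    if "B \<in> carrier_mat n n" "i < m" "j < m" for B i j
    using that Yi Zi by (subst triple_product_index[OF Y _ Z]) auto
  have YPAPZ: "Y * (P * B * P) * Z = Y * B * Z" if "B \<in> carrier_mat n n" for B
    by (rule compression_absorb[OF Y P that Z YP PZ])
  have "card I \<le> cdim n ?W"
  proof (rule card_le_cdim[OF W I(1), of "\<lambda>l. P * A l * P"])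
    show "P * A l * P \<in> ?W" if "l \<in> I" for l using AV[OF that] by blast
    show "indep_rows I (positions n) (\<lambda>l p. (P * A l * P) $$ p)"
    proof (rule indep_rowsI)
      fix c l assume c: "\<And>p. p \<in> positions n \<Longrightarrow> (\<Sum>l\<in>I. c l * (P * A l * P) $$ p) = 0" and l: "l \<in> I"
      have "(\<Sum>l\<in>I. c l * compressed n (\<lambda>l r c. A l $$ (r, c)) (\<lambda>r i. cnj (z r i)) z l (i, j)) = 0"
        if ij: "i < m" "j < m" for i j
      proof -
        have "compressed n (\<lambda>l r c. A l $$ (r, c)) (\<lambda>r i. cnj (z r i)) z l (i, j) =
          (\<Sum>r<n. \<Sum>s<n. cnj (z r i) * (P * A l * P) $$ (r, s) * z s j)" if "l \<in> I" for l
        proof -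
          have "A l \<in> carrier_mat n n" using AV[OF that] Vc by blast
          then show ?thesis
            using form[of "A l", OF _ ij] form[of "P * A l * P", OF _ ij] YPAPZ[of "A l"] P
            by (simp add: compressed_def)
        qed
        then have "(\<Sum>l\<in>I. c l * compressed n (\<lambda>l r c. A l $$ (r, c)) (\<lambda>r i. cnj (z r i)) z l (i, j)) =
            (\<Sum>l\<in>I. \<Sum>r<n. \<Sum>s<n. cnj (z r i) * (c l * (P * A l * P) $$ (r, s)) * z s j)"
          by (simp add: sum_distrib_left mult_ac)
        also have "\<dots> = (\<Sum>r<n. \<Sum>l\<in>I. \<Sum>s<n. cnj (z r i) * (c l * (P * A l * P) $$ (r, s)) * z s j)"
          by (rule sum.swap)
        also have "\<dots> = (\<Sum>r<n. \<Sum>s<n. \<Sum>l\<in>I. cnj (z r i) * (c l * (P * A l * P) $$ (r, s)) * z s j)"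
          by (intro sum.cong refl sum.swap)
        also have "\<dots> = (\<Sum>r<n. \<Sum>s<n. cnj (z r i) * (\<Sum>l\<in>I. c l * (P * A l * P) $$ (r, s)) * z s j)"
          by (simp add: sum_distrib_left sum_distrib_right)
        also have "\<dots> = 0" using c by simp
        finally show ?thesis .
      qed
      then show "c l = 0" by (intro indep_rowsD[OF ind _ l, of c]) auto
    qed
  qed
  moreover have "cdim n ?W \<le> card (positions m)"
  proof (rule cdim_le_card_functionals[OF W, of _ "\<lambda>(i, j) (r, s). cnj (z r i) * z s j"])
    fix B i j assume B: "B \<in> ?W" and ij: "i < n" "j < n"
      and zero: "\<And>p. p \<in> positions m \<Longrightarrow>
        (\<Sum>q\<in>positions n. (case p of (i, j) \<Rightarrow> \<lambda>(r, s). cnj (z r i) * z s j) q * B $$ q) = 0"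
    obtain A where A: "A \<in> V" "B = P * A * P" using B by blast
    have Ac: "A \<in> carrier_mat n n" and Bc: "B \<in> carrier_mat n n" using A Vc P by auto
    have "(Y * B * Z) $$ (i, j) = 0" if "i < m" "j < m" for i j
    proof -
      have "(Y * B * Z) $$ (i, j) = (\<Sum>(r, s)\<in>positions n. cnj (z r i) * B $$ (r, s) * z s j)"
        using form[OF Bc that] by (simp add: sum.cartesian_product)
      also have "\<dots> = (\<Sum>q\<in>positions n. (case (i, j) of (i, j) \<Rightarrow> \<lambda>(r, s). cnj (z r i) * z s j) q * B $$ q)"
        by (intro sum.cong) auto
      finally show ?thesis using zero[of "(i, j)"] that by simp
    qed
    then have YBZ: "Y * B * Z = 0\<^sub>m m m" using Y Z by (intro eq_matI) auto
    have "B = P * B * P" unfolding A(2) using projection_absorb[OF P PP Ac] by simp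
    also have "\<dots> = Z * (H * (Y * B * Z) * (H * Y))"
    proof -
      have YB: "Y * B \<in> carrier_mat m n" and YBZ: "Y * B * Z \<in> carrier_mat m m"
        and ZHY: "Z * (H * Y) \<in> carrier_mat n n" and ZH: "Z * H \<in> carrier_mat n m"
        using Y Z H(1) HY Bc by auto
      have "P * B = Z * (H * (Y * B))"
        unfolding P_def using assoc_mult_mat[OF Z HY Bc] assoc_mult_mat[OF H(1) Y Bc] by simp
      also have "\<dots> * P = Z * (H * (Y * B) * P)"
        using assoc_mult_mat[OF Z mult_carrier_mat[OF H(1) YB] P] by simp
      also have "H * (Y * B) * P = H * (Y * B * P)" by (rule assoc_mult_mat[OF H(1) YB P])
      also have "Y * B * P = Y * B * Z * (H * Y)"
        unfolding P_def using assoc_mult_mat[OF YB Z HY] by simp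
      also have "H * (Y * B * Z * (H * Y)) = H * (Y * B * Z) * (H * Y)"
        by (rule assoc_mult_mat[OF H(1) YBZ HY, symmetric])
      finally show ?thesis .
    qed
    also have "\<dots> = 0\<^sub>m n n" unfolding YBZ using Z H Y HY by simp
    finally show "B $$ (i, j) = 0" using ij by simp
  qed simp
  ultimately have "cdim n ?W = m\<^sup>2" using I(2) cI by simp
  then show ?thesis
    unfolding quantum_clique_def orthogonal_projection_def using P PP adjP rank by auto
qed

lemma large_operator_system_has_clique:
  assumes "mat_subspace n V" "2 * m * n \<le> cdim n V" "0 < n" "0 < m"
  shows "\<exists>P. quantum_clique n m V P"
proof (rule exists_full_compression[OF assms])
  fix I :: "(nat \<times> nat) set" and A z
  assume "finite I" "card I = m\<^sup>2" "\<And>l. l \<in> I \<Longrightarrow> A l \<in> V"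
    "indep_rows I (positions m) (compressed n (\<lambda>l r c. A l $$ (r, c)) (\<lambda>r i. cnj (z r i)) z)"
  then show ?thesis by (rule quantum_clique_of_compression[OF assms(1)])
qed

subsection \<open>Operator systems without cliques\<close>

text \<open>The value \<open>u^* a v\<close>. The kernel \<open>a\<close> is any function of
  positions, so the form applies to the generators of a block as well as to matrices.\<close>

definition sesq :: "nat \<Rightarrow> (nat \<times> nat \<Rightarrow> complex) \<Rightarrow> (nat \<Rightarrow> complex) \<Rightarrow> (nat \<Rightarrow> complex) \<Rightarrow> complex" where
  "sesq n a u v = (\<Sum>(r, s)\<in>positions n. cnj (u r) * a (r, s) * v s)"

lemma sesq_combination:
  "sesq n a (\<lambda>r. \<Sum>i<M. c i * b i r) (\<lambda>s. \<Sum>j<M. d j * b j s) =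
    (\<Sum>(i, j)\<in>positions M. cnj (c i) * d j * sesq n a (b i) (b j))"
proof -
  have "sesq n a (\<lambda>r. \<Sum>i<M. c i * b i r) (\<lambda>s. \<Sum>j<M. d j * b j s) =
      (\<Sum>q\<in>positions n. (\<Sum>i<M. \<Sum>j<M. cnj (c i) * d j * (cnj (b i (fst q)) * a q * b j (snd q))))"
    unfolding sesq_def case_prod_unfold
    by (simp add: sum_distrib_left sum_distrib_right mult_ac)
  also have "\<dots> = (\<Sum>q\<in>positions n. \<Sum>p\<in>positions M.
      cnj (c (fst p)) * d (snd p) * (cnj (b (fst p) (fst q)) * a q * b (snd p) (snd q)))"
    by (simp add: sum.cartesian_product case_prod_unfold)
  also have "\<dots> = (\<Sum>p\<in>positions M. \<Sum>q\<in>positions n.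
      cnj (c (fst p)) * d (snd p) * (cnj (b (fst p) (fst q)) * a q * b (snd p) (snd q)))"
    by (rule sum.swap)
  finally show ?thesis by (simp add: sesq_def sum_distrib_left case_prod_unfold)
qed

text \<open>There are \<open>h\<close> equations in \<open>h + 2\<close> unknowns. After one
  solution is found, the unknown \<open>l0\<close> is dropped, which leaves \<open>h + 1\<close>,
  still enough for a second. The pattern at \<open>l0\<close> and \<open>l1\<close> makes the two
  independent.\<close>

lemma vanishing_combinations:
  fixes b :: "nat \<Rightarrow> nat \<Rightarrow> complex"
  obtains c0 c1 :: "nat \<Rightarrow> complex" and l0 l1 where
    "l0 < h + 2" "l1 < h + 2" "c0 l0 \<noteq> 0" "c1 l0 = 0" "c1 l1 \<noteq> 0"
    "\<And>r. r < h \<Longrightarrow> (\<Sum>l<h + 2. c0 l * b l r) = 0" "\<And>r. r < h \<Longrightarrow> (\<Sum>l<h + 2. c1 l * b l r) = 0"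
proof -
  obtain c0 l0 where c0: "l0 < h + 2" "c0 l0 \<noteq> 0" "\<And>r. r < h \<Longrightarrow> (\<Sum>l<h + 2. c0 l * b l r) = 0"
    using underdetermined_system[of "{..<h}" "{..<h + 2}" b] by auto
  have "card {..<h} < card ({..<h + 2} - {l0})" using c0(1) by simp
  then obtain c l1 where c: "l1 \<in> {..<h + 2} - {l0}" "c l1 \<noteq> 0"
    "\<And>r. r < h \<Longrightarrow> (\<Sum>l\<in>{..<h + 2} - {l0}. c l * b l r) = 0"
    using underdetermined_system[of "{..<h}" "{..<h + 2} - {l0}" b] by auto
  have "(\<Sum>l<h + 2. (c(l0 := 0)) l * b l r) = 0" if "r < h" for r
  proof -
    have "(\<Sum>l<h + 2. (c(l0 := 0)) l * b l r) = (\<Sum>l\<in>{..<h + 2} - {l0}. (c(l0 := 0)) l * b l r)"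
      using c0(1) by (subst sum.remove[of _ l0]) auto
    also have "\<dots> = (\<Sum>l\<in>{..<h + 2} - {l0}. c l * b l r)" by (intro sum.cong) auto
    finally show ?thesis using c(3)[OF that] by simp
  qed
  then show ?thesis using c0 c by (intro that[of l0 l1 c0 "c(l0 := 0)"]) auto
qed

text \<open>
  Among \<open>h + 2\<close> vectors there are two independent combinations \<open>u\<^sub>0, u\<^sub>1\<close> supported on
  the coordinates \<open>\<ge> h\<close>. The four numbers \<open>u\<^sub>\<alpha>\<^sup>* a u\<^sub>\<beta>\<close> only depend on the block of \<open>a\<close>,
  which has fewer than four degrees of freedom, and hence satisfy a linear relation.
\<close>
lemma block_relation:
  fixes b :: "nat \<Rightarrow> nat \<Rightarrow> complex" and g :: "'t \<Rightarrow> nat \<times> nat \<Rightarrow> complex"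
  assumes T: "finite T" "card T < 4"
  obtains \<mu> e where "e \<in> positions (h + 2)" "\<mu> e \<noteq> 0"
    "\<And>a d. \<forall>r s. h \<le> r \<and> r < n \<and> h \<le> s \<and> s < n \<longrightarrow> a (r, s) = (\<Sum>p\<in>T. d p * g p (r, s)) \<Longrightarrow>
      (\<Sum>(i, j)\<in>positions (h + 2). \<mu> (i, j) * sesq n a (b i) (b j)) = 0"
proof -
  obtain c0 c1 :: "nat \<Rightarrow> complex" and l0 l1 where c: "l0 < h + 2" "l1 < h + 2"
    "c0 l0 \<noteq> 0" "c1 l0 = 0" "c1 l1 \<noteq> 0"
    "\<And>r. r < h \<Longrightarrow> (\<Sum>l<h + 2. c0 l * b l r) = 0" "\<And>r. r < h \<Longrightarrow> (\<Sum>l<h + 2. c1 l * b l r) = 0"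
    by (rule vanishing_combinations[where b = b and h = h]) (rule that)
  define c where "c \<alpha> = (if \<alpha> then c1 else c0)" for \<alpha>
  define u where "u \<alpha> r = (\<Sum>l<h + 2. c \<alpha> l * b l r)" for \<alpha> r
  have u0: "u \<alpha> r = 0" if "r < h" for \<alpha> r using c(6,7)[OF that] by (simp add: u_def c_def)
  have UNIV4: "(UNIV :: (bool \<times> bool) set) = {(False, False), (False, True), (True, False), (True, True)}"
    by auto
  \<comment> \<open>Four unknowns, one for each pair of combinations, face fewer than four
    equations. \<open>\<nu>\<close> annihilates all generators \<open>g p\<close> at once, so the
    relation does not depend on the matrix.\<close>
  obtain \<nu> where \<nu>: "\<exists>q\<in>(UNIV :: (bool \<times> bool) set). \<nu> q \<noteq> 0"
    "\<And>p. p \<in> T \<Longrightarrow> (\<Sum>q\<in>UNIV. \<nu> q * sesq n (g p) (u (fst q)) (u (snd q))) = 0"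
    using underdetermined_system[OF T(1), of "UNIV :: (bool \<times> bool) set"
      "\<lambda>q p. sesq n (g p) (u (fst q)) (u (snd q))"] T(2) by (auto simp: UNIV4)
  \<comment> \<open>The relation \<open>\<nu>\<close> expanded from the combinations
    \<open>u\<close> back to the given vectors \<open>b\<close>.\<close>
  define \<mu> where "\<mu> p = (\<Sum>q\<in>UNIV. \<nu> q * (cnj (c (fst q) (fst p)) * c (snd q) (snd p)))" for p
  have "\<exists>e\<in>positions (h + 2). \<mu> e \<noteq> 0"
  proof (rule ccontr)
    assume "\<not> (\<exists>e\<in>positions (h + 2). \<mu> e \<noteq> 0)"
    \<comment> \<open>Because \<open>c1 l0 = 0\<close>, these four equations are triangular in the
      values of \<open>\<nu>\<close>, with nonzero pivots formed from \<open>c0 l0\<close> and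
      \<open>c1 l1\<close>.\<close>
    then have "\<mu> (l0, l0) = 0" "\<mu> (l0, l1) = 0" "\<mu> (l1, l0) = 0" "\<mu> (l1, l1) = 0" using c(1,2) by auto
    then have "\<nu> (False, False) = 0 \<and> \<nu> (False, True) = 0 \<and> \<nu> (True, False) = 0 \<and> \<nu> (True, True) = 0"
      unfolding \<mu>_def UNIV4 using c(3-5) by (auto simp: c_def)
    then show False using \<nu>(1) unfolding UNIV4 by auto
  qed
  then obtain e where e: "e \<in> positions (h + 2)" "\<mu> e \<noteq> 0" by blast
  show ?thesis
  proof (rule that[of e \<mu>, OF e])
    fix a d
    assume a: "\<forall>r s. h \<le> r \<and> r < n \<and> h \<le> s \<and> s < n \<longrightarrow> a (r, s) = (\<Sum>p\<in>T. d p * g p (r, s))"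
    have su: "sesq n a (u \<alpha>) (u \<beta>) = (\<Sum>p\<in>T. d p * sesq n (g p) (u \<alpha>) (u \<beta>))" for \<alpha> \<beta>
    proof -
      have "sesq n a (u \<alpha>) (u \<beta>) = (\<Sum>(r, s)\<in>positions n. \<Sum>p\<in>T. d p * (cnj (u \<alpha> r) * g p (r, s) * u \<beta> s))"
        unfolding sesq_def
      proof (intro sum.cong refl, clarify)
        fix r s assume "r < n" "s < n"
        show "cnj (u \<alpha> r) * a (r, s) * u \<beta> s = (\<Sum>p\<in>T. d p * (cnj (u \<alpha> r) * g p (r, s) * u \<beta> s))"
        proof (cases "h \<le> r \<and> h \<le> s")
          case True
          then show ?thesis using a \<open>r < n\<close> \<open>s < n\<close>
            by (simp add: sum_distrib_left sum_distrib_right mult_ac)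
        next
          case False
          then show ?thesis using u0[of r \<alpha>] u0[of s \<beta>] by auto
        qed
      qed
      then show ?thesis
        unfolding sesq_def case_prod_unfold by (subst (asm) sum.swap) (simp add: sum_distrib_left)
    qed
    have "(\<Sum>(i, j)\<in>positions (h + 2). \<mu> (i, j) * sesq n a (b i) (b j)) =
        (\<Sum>p\<in>positions (h + 2). \<Sum>q\<in>UNIV. \<nu> q * (cnj (c (fst q) (fst p)) * c (snd q) (snd p) *
          sesq n a (b (fst p)) (b (snd p))))"
      unfolding \<mu>_def by (simp add: case_prod_unfold sum_distrib_left sum_distrib_right mult_ac)
    also have "\<dots> = (\<Sum>q\<in>UNIV. \<Sum>p\<in>positions (h + 2). \<nu> q * (cnj (c (fst q) (fst p)) * c (snd q) (snd p) *
          sesq n a (b (fst p)) (b (snd p))))"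
      by (rule sum.swap)
    also have "\<dots> = (\<Sum>q\<in>UNIV. \<nu> q * sesq n a (u (fst q)) (u (snd q)))"
      unfolding u_def sesq_combination by (simp add: sum_distrib_left case_prod_unfold)
    also have "\<dots> = (\<Sum>q\<in>UNIV. \<Sum>p\<in>T. d p * (\<nu> q * sesq n (g p) (u (fst q)) (u (snd q))))"
      unfolding su by (simp add: sum_distrib_left mult_ac)
    also have "\<dots> = (\<Sum>p\<in>T. d p * (\<Sum>q\<in>UNIV. \<nu> q * sesq n (g p) (u (fst q)) (u (snd q))))"
      by (subst sum.swap) (simp add: sum_distrib_left)
    also have "\<dots> = 0" using \<nu>(2) by simp
    finally show "(\<Sum>(i, j)\<in>positions (h + 2). \<mu> (i, j) * sesq n a (b i) (b j)) = 0" .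
  qed
qed

text \<open>For a basis \<open>b\<close> of the range of \<open>P\<close>, a compression is
  determined by the \<open>(h + 2)^2\<close> numbers \<open>b_i^* A b_j\<close>. The fixed relation
  \<open>\<mu>\<close> makes one of them redundant, so the dimension stays below
  \<open>(h + 2)^2\<close>.\<close>

lemma no_clique_of_small_block:
  fixes g :: "'t \<Rightarrow> nat \<times> nat \<Rightarrow> complex"
  assumes V: "mat_subspace n V" and T: "finite T" "card T < 4"
    and block: "\<And>A. A \<in> V \<Longrightarrow> \<exists>d. \<forall>r s. h \<le> r \<and> r < n \<and> h \<le> s \<and> s < n \<longrightarrow> A $$ (r, s) = (\<Sum>p\<in>T. d p * g p (r, s))"
  shows "\<not> quantum_clique n (h + 2) V P"
proof
  assume "quantum_clique n (h + 2) V P"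
  then have P: "P \<in> carrier_mat n n" and PP: "P * P = P" and adjP: "mat_adjoint P = P"
    and rank: "vec_space.rank n P = h + 2" and dim: "cdim n {P * A * P | A. A \<in> V} = (h + 2)\<^sup>2"
    unfolding quantum_clique_def orthogonal_projection_def by auto
  obtain b :: "nat \<Rightarrow> complex vec" and C where
    b: "\<And>l. l < h + 2 \<Longrightarrow> \<exists>x\<in>carrier_vec n. P *\<^sub>v x = b l"
    and PC: "\<And>i j. i < n \<Longrightarrow> j < n \<Longrightarrow> P $$ (i, j) = (\<Sum>l<h + 2. b l $ i * C l j)"
    by (rule rank_obtain_spanning[OF P, unfolded rank]) (rule that)
  define Z where "Z = mat n (h + 2) (\<lambda>(r, l). b l $ r)"
  define D where "D = mat (h + 2) n (\<lambda>(l, j). C l j)"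
  define Y where "Y = mat_adjoint Z"
  define K where "K = mat_adjoint D"
  have Z: "Z \<in> carrier_mat n (h + 2)" and D: "D \<in> carrier_mat (h + 2) n" by (auto simp: Z_def D_def)
  have Y: "Y \<in> carrier_mat (h + 2) n" and K: "K \<in> carrier_mat n (h + 2)"
    using Z D by (auto simp: Y_def K_def)
  have Yi: "Y $$ (i, r) = cnj (b i $ r)" if "i < h + 2" "r < n" for i r
    using mat_adjoint_index[OF Z that] that by (simp add: Y_def Z_def)
  have PZD: "P = Z * D"
    using P Z D PC by (intro eq_matI) (auto simp: Z_def D_def scalar_prod_def lessThan_atLeast0)
  \<comment> \<open>Taking adjoints gives a second factorization of the Hermitian \<open>P\<close>.
    With both, \<open>B = P B P = K (Y B Z) D\<close>, so \<open>Y B Z\<close> determines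
    \<open>B\<close>.\<close>
  have PKY: "P = K * Y" using mat_adjoint_mult[OF Z D] adjP PZD by (simp add: K_def Y_def)
  have PZ: "P * Z = Z"
  proof (rule eq_matI)
    fix r l assume "r < dim_row Z" "l < dim_col Z"
    then have rl: "r < n" "l < h + 2" using Z by auto
    obtain x where x: "x \<in> carrier_vec n" "P *\<^sub>v x = b l" using b[OF rl(2)] by blast
    have "b l \<in> carrier_vec n" using mult_mat_vec_carrier[OF P x(1)] x(2) by simp
    then have "col Z l = b l" using rl by (intro eq_vecI) (auto simp: Z_def)
    moreover have "P *\<^sub>v b l = b l"
      using assoc_mult_mat_vec[OF P P x(1)] PP x(2) by simp
    moreover have "(P * Z) $$ (r, l) = (P *\<^sub>v col Z l) $ r" using P Z rl by simp
    moreover have "Z $$ (r, l) = col Z l $ r" using Z rl by simp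
    ultimately show "(P * Z) $$ (r, l) = Z $$ (r, l)" by simp
  qed (use P Z in auto)
  have YP: "Y * P = Y" using mat_adjoint_mult[OF P Z] PZ adjP by (simp add: Y_def)
  have form: "(Y * B * Z) $$ (i, j) = sesq n (\<lambda>p. B $$ p) (\<lambda>r. b i $ r) (\<lambda>r. b j $ r)"
    if "B \<in> carrier_mat n n" "i < h + 2" "j < h + 2" for B i j
    using that Yi unfolding sesq_def
    by (subst triple_product_index[OF Y _ Z]) (auto simp: Z_def sum.cartesian_product intro!: sum.cong)
  obtain \<mu> e where e: "e \<in> positions (h + 2)" "\<mu> e \<noteq> 0" and
    rel: "\<And>a d. \<forall>r s. h \<le> r \<and> r < n \<and> h \<le> s \<and> s < n \<longrightarrow> a (r, s) = (\<Sum>p\<in>T. d p * g p (r, s)) \<Longrightarrow>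
      (\<Sum>(i, j)\<in>positions (h + 2). \<mu> (i, j) * sesq n a (\<lambda>r. b i $ r) (\<lambda>r. b j $ r)) = 0"
    by (rule block_relation[OF T, where n = n and h = h and g = g and b = "\<lambda>l r. b l $ r"]) (rule that)
  let ?W = "{P * A * P | A. A \<in> V}"
  have W: "mat_subspace n ?W" by (rule mat_subspace_compress[OF V P])
  \<comment> \<open>The entry at \<open>e\<close> is recovered from the other entries through the
    relation, because \<open>\<mu> e \<noteq> 0\<close>; its functional is therefore
    dropped.\<close>
  have "cdim n ?W \<le> card (positions (h + 2) - {e})"
  proof (rule cdim_le_card_functionals[OF W, of _ "\<lambda>(i, j) (r, s). cnj (b i $ r) * b j $ s"])
    fix B i j assume B: "B \<in> ?W" and ij: "i < n" "j < n"
      and zero: "\<And>p. p \<in> positions (h + 2) - {e} \<Longrightarrow>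
        (\<Sum>q\<in>positions n. (case p of (i, j) \<Rightarrow> \<lambda>(r, s). cnj (b i $ r) * b j $ s) q * B $$ q) = 0"
    obtain A where A: "A \<in> V" "B = P * A * P" using B by blast
    have Ac: "A \<in> carrier_mat n n" and Bc: "B \<in> carrier_mat n n"
      using A mat_subspaceD(1)[OF V] P by auto
    have YBZ: "Y * B * Z = Y * A * Z" unfolding A(2) by (rule compression_absorb[OF Y P Ac Z YP PZ])
    have off: "(Y * B * Z) $$ p = 0" if p: "p \<in> positions (h + 2) - {e}" for p
    proof -
      obtain i j where ij: "p = (i, j)" "i < h + 2" "j < h + 2" using p by auto
      have "(Y * B * Z) $$ p = (\<Sum>q\<in>positions n. (case p of (i, j) \<Rightarrow> \<lambda>(r, s). cnj (b i $ r) * b j $ s) q * B $$ q)"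
        unfolding ij(1) form[OF Bc ij(2,3)] sesq_def by (intro sum.cong) auto
      then show ?thesis using zero[OF p] by simp
    qed
    obtain d where "\<forall>r s. h \<le> r \<and> r < n \<and> h \<le> s \<and> s < n \<longrightarrow> A $$ (r, s) = (\<Sum>p\<in>T. d p * g p (r, s))"
      using block[OF A(1)] by blast
    then have "(\<Sum>(i, j)\<in>positions (h + 2). \<mu> (i, j) * sesq n (\<lambda>p. A $$ p) (\<lambda>r. b i $ r) (\<lambda>r. b j $ r)) = 0"
      by (rule rel)
    moreover have "(\<Sum>(i, j)\<in>positions (h + 2). \<mu> (i, j) * sesq n (\<lambda>p. A $$ p) (\<lambda>r. b i $ r) (\<lambda>r. b j $ r)) =
        (\<Sum>p\<in>positions (h + 2). \<mu> p * (Y * B * Z) $$ p)"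
      unfolding YBZ using form[OF Ac] by (intro sum.cong) auto
    moreover have "(\<Sum>p\<in>positions (h + 2). \<mu> p * (Y * B * Z) $$ p) = \<mu> e * (Y * B * Z) $$ e"
      using off by (subst sum.remove[OF _ e(1)]) auto
    ultimately have "(Y * B * Z) $$ e = 0" using e(2) by simp
    then have "(Y * B * Z) $$ p = 0" if "p \<in> positions (h + 2)" for p
      using off[of p] that by (cases "p = e") auto
    then have YBZ0: "Y * B * Z = 0\<^sub>m (h + 2) (h + 2)" using Y Z by (intro eq_matI) auto
    have KY: "K * Y \<in> carrier_mat n n" and YB: "Y * B \<in> carrier_mat (h + 2) n" using K Y Bc by auto
    have "B = P * B * P" unfolding A(2) using projection_absorb[OF P PP Ac] by simp
    also have "\<dots> = (K * Y) * B * (Z * D)" using PKY PZD by simp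
    also have "(K * Y) * B = K * (Y * B)" by (rule assoc_mult_mat[OF K Y Bc])
    also have "K * (Y * B) * (Z * D) = K * ((Y * B) * (Z * D))"
      by (rule assoc_mult_mat[OF K YB mult_carrier_mat[OF Z D]])
    also have "(Y * B) * (Z * D) = (Y * B * Z) * D" by (rule assoc_mult_mat[OF YB Z D, symmetric])
    also have "K * ((Y * B * Z) * D) = 0\<^sub>m n n" unfolding YBZ0 using K D by simp
    finally show "B $$ (i, j) = 0" using ij by simp
  qed simp
  also have "\<dots> < card (positions (h + 2))" using e(1) by (intro psubset_card_mono) auto
  finally show False using dim by (simp add: card_cartesian_product power2_eq_square)
qed

section \<open>A large system with a three-dimensional corner\<close>

text \<open>
  The lower right block ranges over the span of the identity and of the two matrix units at
  \<open>(n - 2, n - 1)\<close> and \<open>(n - 1, n - 2)\<close>; the position \<open>(n - 1, n - 1)\<close> serves as the index of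
  the identity.
\<close>
definition corner :: "nat \<times> nat \<Rightarrow> nat \<times> nat \<Rightarrow> complex" where
  "corner p q = (if fst p = snd p then if fst q = snd q then 1 else 0 else if q = p then 1 else 0)"

definition corner_positions :: "nat \<Rightarrow> (nat \<times> nat) set" where
  "corner_positions n = {(n - 1, n - 1), (n - 2, n - 1), (n - 1, n - 2)}"

definition corner_system :: "nat \<Rightarrow> nat \<Rightarrow> complex mat set" where
  "corner_system n h = {A \<in> carrier_mat n n. \<exists>d. \<forall>r s. h \<le> r \<and> r < n \<and> h \<le> s \<and> s < n \<longrightarrow>
     A $$ (r, s) = (\<Sum>p\<in>corner_positions n. d p * corner p (r, s))}"

lemma operator_system_corner: "operator_system n (corner_system n h)"
  unfolding operator_system_def
proof (intro conjI ballI mat_subspaceI)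
  show "corner_system n h \<subseteq> carrier_mat n n" by (auto simp: corner_system_def)
  show "0\<^sub>m n n \<in> corner_system n h"
    by (auto simp: corner_system_def intro!: exI[of _ "\<lambda>_. 0"])
  have "finite (corner_positions n)" by (simp add: corner_positions_def)
  then have "(\<Sum>p\<in>corner_positions n. (if p = (n - 1, n - 1) then 1 else 0) * corner p (r, s)) =
      corner (n - 1, n - 1) (r, s)" for r s
    by (intro sum_unit_functional) (auto simp: corner_positions_def)
  then have "(\<Sum>p\<in>corner_positions n. (if p = (n - 1, n - 1) then 1 else 0) * corner p (r, s)) =
      (if r = s then 1 else 0)" for r s
    by (simp add: corner_def[of "(n - Suc 0, n - Suc 0)"])
  then show "1\<^sub>m n \<in> corner_system n h"
    by (auto simp: corner_system_def intro!: exI[of _ "\<lambda>p. if p = (n - 1, n - 1) then 1 else 0"])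
next
  fix A B assume "A \<in> corner_system n h" "B \<in> corner_system n h"
  then obtain d d' where A: "A \<in> carrier_mat n n" "B \<in> carrier_mat n n"
    "\<forall>r s. h \<le> r \<and> r < n \<and> h \<le> s \<and> s < n \<longrightarrow> A $$ (r, s) = (\<Sum>p\<in>corner_positions n. d p * corner p (r, s))"
    "\<forall>r s. h \<le> r \<and> r < n \<and> h \<le> s \<and> s < n \<longrightarrow> B $$ (r, s) = (\<Sum>p\<in>corner_positions n. d' p * corner p (r, s))"
    by (auto simp: corner_system_def)
  then show "A + B \<in> corner_system n h"
    by (auto simp: corner_system_def sum.distrib distrib_right intro!: exI[of _ "\<lambda>p. d p + d' p"])
next
  fix c A assume "A \<in> corner_system n h"
  then obtain d where A: "A \<in> carrier_mat n n"
    "\<forall>r s. h \<le> r \<and> r < n \<and> h \<le> s \<and> s < n \<longrightarrow> A $$ (r, s) = (\<Sum>p\<in>corner_positions n. d p * corner p (r, s))"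
    by (auto simp: corner_system_def)
  then show "c \<cdot>\<^sub>m A \<in> corner_system n h"
    by (auto simp: corner_system_def sum_distrib_left mult.assoc intro!: exI[of _ "\<lambda>p. c * d p"])
next
  fix A assume "A \<in> corner_system n h"
  then obtain d where A: "A \<in> carrier_mat n n"
    "\<forall>r s. h \<le> r \<and> r < n \<and> h \<le> s \<and> s < n \<longrightarrow> A $$ (r, s) = (\<Sum>p\<in>corner_positions n. d p * corner p (r, s))"
    by (auto simp: corner_system_def)
  \<comment> \<open>The adjoint fixes the identity and exchanges the two matrix units: coefficients
    are conjugated and permuted by the swap, under which the index set is stable.\<close>
  have swap: "bij_betw prod.swap (corner_positions n) (corner_positions n)"
    by (rule bij_betwI[of _ _ _ prod.swap]) (auto simp: corner_positions_def)
  have "(\<Sum>p\<in>corner_positions n. cnj (d p) * cnj (corner p (s, r))) =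
      (\<Sum>p\<in>corner_positions n. cnj (d (prod.swap p)) * corner p (r, s))" for r s
    by (subst sum.reindex_bij_betw[OF swap, symmetric]) (auto simp: corner_def intro!: sum.cong)
  then show "mat_adjoint A \<in> corner_system n h"
    using A by (auto simp: corner_system_def intro!: exI[of _ "\<lambda>p. cnj (d (prod.swap p))"])
qed

lemma mat_subspace_operator_system: "operator_system n V \<Longrightarrow> mat_subspace n V"
  by (simp add: operator_system_def)

lemma no_clique_corner: "\<not> quantum_clique n (h + 2) (corner_system n h) P"
proof (rule no_clique_of_small_block[OF mat_subspace_operator_system[OF operator_system_corner]])
  show "finite (corner_positions n)" by (simp add: corner_positions_def)
  \<comment> \<open>For \<open>n \<le> 1\<close> truncated subtraction makes the three positions
    coincide, so only an inequality holds in general.\<close>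
  have "card (corner_positions n) \<le> 3" unfolding corner_positions_def
    by (simp add: card_insert_if)
  then show "card (corner_positions n) < 4" by simp
qed (auto simp: corner_system_def)

lemma mat_index_positions: "q \<in> positions n \<Longrightarrow> mat n n f $$ q = f q"
  by (cases q) simp

text \<open>The matrix units outside the block and the three block generators are independent:
  evaluated at their own index positions they form an identity matrix.\<close>

lemma cdim_corner_ge:
  assumes "h + 2 \<le> n"
  shows "int n ^ 2 - (int n - int h)\<^sup>2 + 3 \<le> int (cdim n (corner_system n h))"
proof -
  let ?B = "{h..<n} \<times> {h..<n}"
  let ?S = "positions n - ?B"
  have T: "finite (corner_positions n)" "card (corner_positions n) = 3" "corner_positions n \<subseteq> ?B"
    using assms by (auto simp: corner_positions_def)
  have "card ?S = card (positions n) - card ?B" by (intro card_Diff_subset) auto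
  moreover have "card ?B \<le> card (positions n)" by (intro card_mono) auto
  ultimately have cS: "int (card ?S) = int n ^ 2 - (int n - int h)\<^sup>2"
    using assms by (simp add: card_cartesian_product power2_eq_square of_nat_diff)
  define I where "I = ?S \<union> corner_positions n"
  have fI: "finite I" and cI: "card I = card ?S + 3"
  proof -
    have "?S \<inter> corner_positions n = {}" using T(3) by blast
    then have "card (?S \<union> corner_positions n) = card ?S + card (corner_positions n)"
      using T(1) by (intro card_Un_disjoint) auto
    then show "finite I" "card I = card ?S + 3" unfolding I_def using T by auto
  qed
  define b :: "nat \<times> nat \<Rightarrow> complex mat" where
    "b p = mat n n (\<lambda>q. if p \<in> ?S then if p = q then 1 else 0 else if q \<in> ?B then corner p q else 0)" for p
  have bi: "b p $$ q = (if p = q then 1 else 0)" if "p \<in> I" "q \<in> I" for p q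
  proof -
    have "q \<in> positions n" using that T(3) unfolding I_def by auto
    then have bq: "b p $$ q = (if p \<in> ?S then if p = q then 1 else 0 else if q \<in> ?B then corner p q else 0)"
      by (simp only: b_def mat_index_positions)
    show ?thesis
    proof (cases "p \<in> ?S")
      case True
      then show ?thesis using bq by simp
    next
      case False
      then have p: "p \<in> corner_positions n" using that(1) unfolding I_def by blast
      show ?thesis
      proof (cases "q \<in> ?S")
        case True
        then show ?thesis using bq False by auto
      next
        case False
        then have q: "q \<in> corner_positions n" using that(2) unfolding I_def by blast
        \<comment> \<open>The identity of the block has several diagonal entries, but among the
          three corner positions it is nonzero only at its own index
          \<open>(n - 1, n - 1)\<close>.\<close>
        have "corner p q = (if p = q then 1 else 0)"
          using p q assms by (auto simp: corner_positions_def corner_def)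
        then show ?thesis using bq p q T(3) by auto
      qed
    qed
  qed
  have "card I \<le> cdim n (corner_system n h)"
  proof (rule card_le_cdim[OF mat_subspace_operator_system[OF operator_system_corner] fI, of b])
    fix p assume p: "p \<in> I"
    show "b p \<in> corner_system n h"
    proof (cases "p \<in> ?S")
      case True
      then show ?thesis
        by (auto simp: corner_system_def b_def intro!: exI[of _ "\<lambda>_. 0"])
    next
      case False
      then have "p \<in> corner_positions n" using p unfolding I_def by blast
      then have "(\<Sum>q\<in>corner_positions n. (if q = p then 1 else 0) * corner q (r, s)) = corner p (r, s)" for r s
        using T(1) by (intro sum_unit_functional)
      moreover have "b p $$ (r, s) = corner p (r, s)" if "h \<le> r \<and> r < n \<and> h \<le> s \<and> s < n" for r s
        using that False unfolding b_def by (subst index_mat) auto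
      moreover have "b p \<in> carrier_mat n n" by (simp add: b_def)
      ultimately show ?thesis unfolding corner_system_def
        by (auto intro!: exI[of _ "\<lambda>q. if q = p then 1 else 0"])
    qed
  next
    show "indep_rows I (positions n) (\<lambda>l p. b l $$ p)"
    proof (rule indep_rowsI)
      fix c q assume c: "\<And>p. p \<in> positions n \<Longrightarrow> (\<Sum>l\<in>I. c l * b l $$ p) = 0" and q: "q \<in> I"
      have "q \<in> positions n" using q T(3) unfolding I_def by auto
      then have "(\<Sum>l\<in>I. c l * b l $$ q) = 0" by (rule c)
      moreover have "(\<Sum>l\<in>I. c l * b l $$ q) = (\<Sum>l\<in>I. (if l = q then 1 else 0) * c l)"
        using bi q by (intro sum.cong) auto
      ultimately show "c q = 0" using sum_unit_functional[OF fI q, of c] by simp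
    qed
  qed
  then show ?thesis using cI cS by simp
qed

lemma operator_system_full: "operator_system n (carrier_mat n n)"
  unfolding operator_system_def by (auto intro: mat_subspaceI)

lemma cdim_full: "n\<^sup>2 \<le> cdim n (carrier_mat n n)"
proof -
  let ?b = "\<lambda>p. mat n n (\<lambda>q. if p = q then 1 else 0 :: complex)"
  have "card (positions n) \<le> cdim n (carrier_mat n n)"
  proof (rule card_le_cdim[OF mat_subspace_operator_system[OF operator_system_full], of _ ?b])
    show "indep_rows (positions n) (positions n) (\<lambda>l p. ?b l $$ p)"
    proof (rule indep_rowsI)
      fix c q assume c: "\<And>p. p \<in> positions n \<Longrightarrow> (\<Sum>l\<in>positions n. c l * ?b l $$ p) = 0"
        and q: "q \<in> positions n"
      have "(\<Sum>l\<in>positions n. c l * ?b l $$ q) = (\<Sum>l\<in>positions n. (if l = q then 1 else 0) * c l)"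
        by (intro sum.cong refl) (simp add: mat_index_positions[OF q])
      then show "c q = 0" using c[OF q] sum_unit_functional[OF _ q, of c] by simp
    qed
  qed auto
  then show ?thesis by (simp add: card_cartesian_product power2_eq_square)
qed

lemma no_clique_above_size:
  assumes "n < m"
  shows "\<not> quantum_clique n m V P"
proof
  assume "quantum_clique n m V P"
  then have "P \<in> carrier_mat n n" "vec_space.rank n P = m"
    by (auto simp: quantum_clique_def orthogonal_projection_def)
  then show False using vec_space.rank_le_nc[of P n n] assms by simp
qed

section \<open>Bounds for the Turan number\<close>

lemma finite_turan_dims: "finite (turan_dims n k)"
proof (rule finite_subset)
  show "turan_dims n k \<subseteq> {..n\<^sup>2}"
    using cdim_le_square mat_subspace_operator_system unfolding turan_dims_def by fastforce
qed simp

text \<open>Nonemptiness is recorded as well, since bounding a \<open>Max\<close> strictly from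
  above requires it.\<close>

lemma cdim_le_upper_quantum_turan:
  assumes "operator_system n V" "\<And>P. \<not> quantum_clique n (k + 1) V P"
  shows "turan_dims n k \<noteq> {}" "cdim n V \<le> upper_quantum_turan n k"
proof -
  have "cdim n V \<in> turan_dims n k" using assms unfolding turan_dims_def by blast
  then show "turan_dims n k \<noteq> {}" "cdim n V \<le> upper_quantum_turan n k"
    unfolding upper_quantum_turan_def using Max_ge[OF finite_turan_dims] by auto
qed

lemma upper_quantum_turan_ge_full:
  assumes "n \<le> k"
  shows "turan_dims n k \<noteq> {}" "n\<^sup>2 \<le> upper_quantum_turan n k"
  using cdim_le_upper_quantum_turan[OF operator_system_full, of n k] no_clique_above_size[of n "k + 1"]
    cdim_full[of n] assms by (auto simp: less_Suc_eq_le)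

lemma upper_quantum_turan_ge_corner:
  assumes "1 \<le> k" "k < n"
  shows "turan_dims n k \<noteq> {}"
    "2 * (int k - 1) * int n - (int k - 1)\<^sup>2 + 3 \<le> int (upper_quantum_turan n k)"
proof -
  \<comment> \<open>With this \<open>h\<close> the forbidden rank \<open>k + 1\<close> is
    \<open>h + 2\<close>, and the block has size \<open>n - h = n - k + 1\<close>.\<close>
  define h where "h = k - 1"
  have k: "k + 1 = h + 2" and h: "h + 2 \<le> n" "int h = int k - 1" using assms by (auto simp: h_def)
  note corner = cdim_le_upper_quantum_turan[OF operator_system_corner, of n k h,
      unfolded k, OF no_clique_corner]
  show "turan_dims n k \<noteq> {}" by (rule corner(1))
  have "2 * (int k - 1) * int n - (int k - 1)\<^sup>2 + 3 = int n ^ 2 - (int n - int h)\<^sup>2 + 3"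
    unfolding h(2) by (simp add: power2_eq_square algebra_simps)
  then show "2 * (int k - 1) * int n - (int k - 1)\<^sup>2 + 3 \<le> int (upper_quantum_turan n k)"
    using cdim_corner_ge[OF h(1)] corner(2) by linarith
qed

theorem corollary3p8:
  fixes n k :: nat
  assumes "n \<ge> 1" and "k \<ge> 1"
  shows "(k \<notin> {n, n + 1, n + 2} \<longrightarrow>
            2 * (int k - 1) * int n - (int k - 1)\<^sup>2 + 3 \<le> int (upper_quantum_turan n k)) \<and>
         upper_quantum_turan n k < 16 * (k + 1) ^ 8 * n"
proof (intro conjI impI)
  assume k: "k \<notin> {n, n + 1, n + 2}"
  show "2 * (int k - 1) * int n - (int k - 1)\<^sup>2 + 3 \<le> int (upper_quantum_turan n k)"
  proof (cases "k < n")
    case True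
    then show ?thesis using upper_quantum_turan_ge_corner(2) assms by blast
  next
    case False
    \<comment> \<open>Completing the square writes the claimed bound as
      \<open>n^2 - (k - 1 - n)^2 + 3\<close>. Here the subtracted square is at least
      \<open>4\<close>, so the bound is at most \<open>n^2\<close>, the dimension of the full matrix
      algebra.\<close>
    then have "2 \<le> int k - 1 - int n" using k by auto
    then have "2\<^sup>2 \<le> (int k - 1 - int n)\<^sup>2" by (intro power_mono) auto
    moreover have "2 * (int k - 1) * int n - (int k - 1)\<^sup>2 + 3 = int n ^ 2 - (int k - 1 - int n)\<^sup>2 + 3"
      by (simp add: power2_eq_square algebra_simps)
    ultimately have "2 * (int k - 1) * int n - (int k - 1)\<^sup>2 + 3 \<le> int (n\<^sup>2)" by simp
    also have "\<dots> \<le> int (upper_quantum_turan n k)"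
      using upper_quantum_turan_ge_full(2)[of n k] False by simp
    finally show ?thesis .
  qed
next
  have "turan_dims n k \<noteq> {}"
    using upper_quantum_turan_ge_full(1)[of n k] upper_quantum_turan_ge_corner(1)[of k n] assms by linarith
  moreover have "d < 16 * (k + 1) ^ 8 * n" if d: "d \<in> turan_dims n k" for d
  proof (rule ccontr)
    assume "\<not> d < 16 * (k + 1) ^ 8 * n"
    moreover obtain V where V: "d = cdim n V" "operator_system n V" "\<nexists>P. quantum_clique n (k + 1) V P"
      using d unfolding turan_dims_def by blast
    \<comment> \<open>The clique threshold \<open>2 m n\<close> with \<open>m = k + 1\<close> is
      reached well before the stated bound.\<close>
    moreover have "2 * (k + 1) * n \<le> 16 * (k + 1) ^ 8 * n"
    proof -
      have "(k + 1) ^ 1 \<le> (k + 1) ^ 8" by (rule power_increasing) auto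
      then show ?thesis by (intro mult_le_mono) auto
    qed
    ultimately have "2 * (k + 1) * n \<le> cdim n V" by linarith
    then show False
      using large_operator_system_has_clique[OF mat_subspace_operator_system[OF V(2)]] assms(1) V(3) by simp
  qed
  ultimately show "upper_quantum_turan n k < 16 * (k + 1) ^ 8 * n"
    unfolding upper_quantum_turan_def using finite_turan_dims by (subst Max_less_iff) auto
qed

end
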